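(* Let $G$ be a graph, let $\mathbf X=(X_i)_{i\in V(G)}$ be a $G$-dependent random vector, and let $\mathbf c=(c_i)_{i\in V(G)}$ be a vector of non-negative reals. If for every $i\in V(G)$ the random variable $X_i$ takes values in a real interval of length $c_i\ge 0$, then for every $t>0$, $$\mathbb P\left(\sum_{i\in V(G)}X_i-\mathbb E\left[\sum_{i\in V(G)}X_i\right]\ge t\right)\le\exp\left(-\frac{2t^2}{D(G,\mathbf c)}\right),$$ where $$D(G,\mathbf c):=\min_{\{(F_k,w_k)\}_k\in\mathsf{FFC}(G)}\left(\sum_k w_k\sqrt{\sum_{\{i,j\}\in E(G[F_k])}(c_i+c_j)^2+\sum_{T\in\mathcal T(F_k)}c_{\min,k,T}^2}\right)^2$$ and $c_{\min,k,T}:=\min\{c_i:i\in T\}$ for all $T\in\mathcal T(F_k)$.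
   Context: Graphs are finite, undirected and simple; $V(G)$, $E(G)$ are the vertex and edge sets and $G[S]$ is the subgraph of $G$ induced by $S\subseteq V(G)$. A forest is a disjoint union of trees. $G$-dependence: $\mathbf X$ is $G$-dependent if for any disjoint $S,T\subset V(G)$ that are non-adjacent in $G$ (no edge of $G$ has one endpoint in $S$ and the other in $T$), the families $\{X_i\}_{i\in S}$ and $\{X_j\}_{j\in T}$ are independent. Fractional covers: a finite family $\{(S_k,w_k)\}_k$ with $S_k\subseteq V(G)$ and $w_k\in[0,1]$ is a fractional vertex cover of $G$ if $\sum_{k:v\in S_k}w_k=1$ for every $v\in V(G)$. A fractional forest vertex cover $\{(F_k,w_k)\}_k$ is a fractional vertex cover such that each $G[F_k]$ is a forest. $\mathsf{FFC}(G)$ is the set of all fractional forest vertex covers of $G$. $\mathcal T(F_k)$ is the set of vertex sets of the disjoint trees (connected components) of the forest $G[F_k]$. *)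

theory Defs
  imports "HOL-Probability.Probability"
begin

text \<open>
  A graph is given by its vertex set \<open>V\<close> and its set \<open>E\<close> of edges, an edge being a set of two
  vertices. (In the AFP entry Graph_Theory a symmetric pair of arcs is a cycle of length two, so
  its notion of forest cannot be applied to undirected graphs coded as symmetric digraphs.)
\<close>

definition simple_graph :: "'v set \<Rightarrow> 'v set set \<Rightarrow> bool" where
  "simple_graph V E \<longleftrightarrow> finite V \<and> (\<forall>e\<in>E. e \<subseteq> V \<and> card e = 2)"

text \<open>The induced subgraph on \<open>S\<close> has vertex set \<open>S\<close> and edge set \<open>induced_edges E S\<close>.\<close>

definition induced_edges :: "'v set set \<Rightarrow> 'v set \<Rightarrow> 'v set set" where
  "induced_edges E S = {e \<in> E. e \<subseteq> S}"

definition reachable :: "'v set set \<Rightarrow> 'v \<Rightarrow> 'v \<Rightarrow> bool" where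
  "reachable E u v \<longleftrightarrow> (u, v) \<in> {(x, y). {x, y} \<in> E}\<^sup>*"

definition graph_connected :: "'v set \<Rightarrow> 'v set set \<Rightarrow> bool" where
  "graph_connected V E \<longleftrightarrow> V \<noteq> {} \<and> (\<forall>u\<in>V. \<forall>v\<in>V. reachable E u v)"

definition components :: "'v set \<Rightarrow> 'v set set \<Rightarrow> 'v set set" where
  "components V E = V // {(u, v) \<in> V \<times> V. reachable E u v}"

text \<open>A cycle is the list of its vertices; the last vertex is joined to the first one.\<close>

definition graph_cycle :: "'v set set \<Rightarrow> 'v list \<Rightarrow> bool" where
  "graph_cycle E p \<longleftrightarrow> 3 \<le> length p \<and> distinct p \<and>
     (\<forall>i<length p. {p ! i, p ! (Suc i mod length p)} \<in> E)"

definition is_tree :: "'v set \<Rightarrow> 'v set set \<Rightarrow> bool" where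
  "is_tree V E \<longleftrightarrow> graph_connected V E \<and> (\<nexists>p. graph_cycle E p)"

definition is_forest :: "'v set \<Rightarrow> 'v set set \<Rightarrow> bool" where
  "is_forest V E \<longleftrightarrow> (\<forall>T\<in>components V E. is_tree T (induced_edges E T))"

text \<open>
  A finite family of weighted vertex sets is a list of pairs; the same set may occur several times.
\<close>

definition fractional_vertex_cover :: "'v set \<Rightarrow> ('v set \<times> real) list \<Rightarrow> bool" where
  "fractional_vertex_cover V C \<longleftrightarrow>
     (\<forall>(S, w)\<in>set C. S \<subseteq> V \<and> 0 \<le> w \<and> w \<le> 1) \<and>
     (\<forall>v\<in>V. (\<Sum>(S, w)\<leftarrow>C. if v \<in> S then w else 0) = 1)"

definition FFC :: "'v set \<Rightarrow> 'v set set \<Rightarrow> ('v set \<times> real) list set" where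
  "FFC V E = {C. fractional_vertex_cover V C \<and>
                 (\<forall>(F, w)\<in>set C. is_forest F (induced_edges E F))}"

text \<open>For an edge \<open>e = {i, j}\<close>, the inner sum over \<open>e\<close> is \<open>c i + c j\<close>.\<close>

definition cover_value :: "'v set set \<Rightarrow> ('v \<Rightarrow> real) \<Rightarrow> ('v set \<times> real) list \<Rightarrow> real" where
  "cover_value E c C =
     (\<Sum>(F, w)\<leftarrow>C. w * sqrt ((\<Sum>e\<in>induced_edges E F. (\<Sum>i\<in>e. c i)\<^sup>2)
                        + (\<Sum>T\<in>components F (induced_edges E F). (Min (c ` T))\<^sup>2)))\<^sup>2"

text \<open>
  The minimum is attained although \<open>FFC V E\<close> is infinite: merging equal sets and dropping the empty
  set does not change the value, and the remaining covers form a nonempty compact set of weight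
  vectors indexed by the nonempty subsets of \<open>V\<close>.
\<close>

definition D :: "'v set \<Rightarrow> 'v set set \<Rightarrow> ('v \<Rightarrow> real) \<Rightarrow> real" where
  "D V E c = (LEAST d. d \<in> cover_value E c ` FFC V E)"

text \<open>
  Independence of two families of random variables is independence of the two random vectors,
  with values in the product measurable spaces over \<open>S\<close> and \<open>T\<close>.
\<close>

definition graph_dependent ::
  "'a measure \<Rightarrow> 'v set \<Rightarrow> 'v set set \<Rightarrow> ('v \<Rightarrow> 'a \<Rightarrow> real) \<Rightarrow> bool" where
  "graph_dependent M V E X \<longleftrightarrow>
     (\<forall>S T. S \<subseteq> V \<longrightarrow> T \<subseteq> V \<longrightarrow> S \<inter> T = {} \<longrightarrow> (\<forall>u\<in>S. \<forall>v\<in>T. {u, v} \<notin> E) \<longrightarrow>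
        prob_space.indep_var M
          (\<Pi>\<^sub>M i\<in>S. borel) (\<lambda>\<omega>. \<lambda>i\<in>S. X i \<omega>)
          (\<Pi>\<^sub>M j\<in>T. borel) (\<lambda>\<omega>. \<lambda>j\<in>T. X j \<omega>))"

end

theory Submission
  imports Defs
begin

text \<open>
  For a forest cover, write \<open>\<Sum>\<^sub>i X\<^sub>i\<close> as the weighted sum of the forest sums and combine their
  moment generating functions by convexity of \<open>exp\<close>, the forest \<open>F\<^sub>k\<close> getting a probability
  proportional to \<open>w\<^sub>k\<close> times the square root of its bound. For a single forest, remove a leaf \<open>v\<close>
  with neighbour \<open>p\<close>: conditioning on \<open>X\<^sub>v\<close> preserves graph dependence of the remaining variables
  and moves, among their means, only that of \<open>X\<^sub>p\<close>, so Hoeffding's lemma applies to a variable with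
  range \<open>c\<^sub>v + c\<^sub>p\<close>. In each tree the last vertex left is one of minimal \<open>c\<close>. To condition on events
  of positive probability only, the variables are first rounded to a finite grid.
\<close>

subsection \<open>Conditioning on one vertex\<close>

text \<open>Why forests: if the removed vertex had two neighbours among the rest, conditioning on it
  could create dependence between two non-adjacent sets that each contain one of them, and the
  induction would lose its hypothesis. With a single neighbour \<open>p\<close>, one of the two sets
  misses \<open>p\<close> and keeps its law. Why this bound: the remaining variables keep their
  intervals under conditioning, and the conditional mean at \<open>p\<close> stays in the interval
  of \<open>p\<close>, so the increment due to \<open>v\<close> has range \<open>c v + c p\<close>.
  A vertex without a neighbour left costs only \<open>c v\<close>. This happens once per tree, and a
  leaf order may end at any vertex of the tree, whence the minimum. Why convexity: the forests of a
  cover may overlap and be joined by edges, so their sums need not be independent and the moment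
  generating function of the total does not factor. The constant 2 comes from the 1/8 in Hoeffding's
  lemma after optimising the exponential Markov inequality.\<close>

text \<open>
  For variables with finite range, independence of two families reduces to point masses.
\<close>

definition point_indep :: "'a measure \<Rightarrow> ('v \<Rightarrow> 'a \<Rightarrow> real) \<Rightarrow> 'v set \<Rightarrow> 'v set \<Rightarrow> bool" where
  "point_indep M X S T \<longleftrightarrow> (\<forall>a.
     measure M {\<omega>\<in>space M. \<forall>i\<in>S \<union> T. X i \<omega> = a i} =
     measure M {\<omega>\<in>space M. \<forall>i\<in>S. X i \<omega> = a i} * measure M {\<omega>\<in>space M. \<forall>i\<in>T. X i \<omega> = a i})"

definition point_dependent :: "'a measure \<Rightarrow> 'v set \<Rightarrow> 'v set set \<Rightarrow> ('v \<Rightarrow> 'a \<Rightarrow> real) \<Rightarrow> bool" where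
  "point_dependent M V E X \<longleftrightarrow>
     (\<forall>S T. S \<subseteq> V \<longrightarrow> T \<subseteq> V \<longrightarrow> S \<inter> T = {} \<longrightarrow> (\<forall>u\<in>S. \<forall>v\<in>T. {u, v} \<notin> E) \<longrightarrow> point_indep M X S T)"

lemma point_indep_sym: "point_indep M X S T \<longleftrightarrow> point_indep M X T S"
  by (simp add: point_indep_def Un_commute mult.commute)

lemma point_dependent_subset:
  assumes "point_dependent M V E X" "A \<subseteq> V"
  shows "point_dependent M A E X"
  using assms unfolding point_dependent_def by (meson subset_trans)

section \<open>Expectations of bounded variables and of variables with finite range\<close>

lemma (in prob_space) integral_uniform_measure:
  fixes f :: "'a \<Rightarrow> real"
  assumes [measurable]: "A \<in> events" "random_variable borel f" and "prob A \<noteq> 0"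
  shows "(\<integral>\<omega>. f \<omega> \<partial>uniform_measure M A) = (\<integral>\<omega>. indicator A \<omega> * f \<omega> \<partial>M) / prob A"
proof -
  have pos: "prob A > 0"
    using assms(3) by (simp add: zero_less_measure_iff)
  have "uniform_measure M A = density M (\<lambda>x. ennreal (indicator A x / prob A))"
    unfolding uniform_measure_def using pos
    by (intro arg_cong2[where f=density] ext)
       (auto simp: indicator_def emeasure_eq_measure divide_ennreal simp flip: ennreal_1)
  then have "(\<integral>\<omega>. f \<omega> \<partial>uniform_measure M A) = (\<integral>\<omega>. (indicator A \<omega> / prob A) *\<^sub>R f \<omega> \<partial>M)"
    using pos by (simp add: integral_density)
  then show ?thesis by simp
qed

lemma (in prob_space) expectation_split:
  fixes f :: "'a \<Rightarrow> real" and Y :: "'a \<Rightarrow> real"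
  assumes [measurable]: "random_variable borel Y" and fin: "finite (Y ` space M)"
    and f: "integrable M f"
  shows "expectation f = (\<Sum>y\<in>Y ` space M. \<integral>\<omega>. indicator {\<omega>\<in>space M. Y \<omega> = y} \<omega> * f \<omega> \<partial>M)"
proof -
  have "expectation f = (\<integral>\<omega>. (\<Sum>y\<in>Y ` space M. indicator {\<omega>\<in>space M. Y \<omega> = y} \<omega> * f \<omega>) \<partial>M)"
  proof (rule Bochner_Integration.integral_cong)
    fix \<omega> assume "\<omega> \<in> space M"
    then have "(\<Sum>y\<in>Y ` space M. indicator {\<omega>\<in>space M. Y \<omega> = y} \<omega> * f \<omega>)
        = (\<Sum>y\<in>Y ` space M. if y = Y \<omega> then f \<omega> else 0)"
      by (intro sum.cong) auto
    also have "\<dots> = f \<omega>" using fin \<open>\<omega> \<in> space M\<close> by simp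
    finally show "f \<omega> = (\<Sum>y\<in>Y ` space M. indicator {\<omega>\<in>space M. Y \<omega> = y} \<omega> * f \<omega>)" by simp
  qed simp
  also have "\<dots> = (\<Sum>y\<in>Y ` space M. \<integral>\<omega>. indicator {\<omega>\<in>space M. Y \<omega> = y} \<omega> * f \<omega> \<partial>M)"
    by (intro Bochner_Integration.integral_sum integrable_mult_indicator[where 'b=real, simplified] f) simp
  finally show ?thesis .
qed

lemma (in prob_space) expectation_finite_range:
  fixes g :: "real \<Rightarrow> real" and Y :: "'a \<Rightarrow> real"
  assumes [measurable]: "random_variable borel Y" and fin: "finite (Y ` space M)"
    and int: "integrable M (\<lambda>\<omega>. g (Y \<omega>))"
  shows "expectation (\<lambda>\<omega>. g (Y \<omega>)) = (\<Sum>y\<in>Y ` space M. g y * prob {\<omega>\<in>space M. Y \<omega> = y})"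
proof -
  have "(\<integral>\<omega>. indicator {\<omega>\<in>space M. Y \<omega> = y} \<omega> * g (Y \<omega>) \<partial>M) = g y * prob {\<omega>\<in>space M. Y \<omega> = y}" for y
  proof -
    have "(\<integral>\<omega>. indicator {\<omega>\<in>space M. Y \<omega> = y} \<omega> * g (Y \<omega>) \<partial>M)
        = (\<integral>\<omega>. g y * indicator {\<omega>\<in>space M. Y \<omega> = y} \<omega> \<partial>M)"
      by (intro Bochner_Integration.integral_cong) (auto simp: indicator_def)
    then show ?thesis by simp
  qed
  then show ?thesis using expectation_split[OF assms(1,2) int] by simp
qed

lemma (in prob_space) integrable_interval:
  fixes f :: "'a \<Rightarrow> real"
  assumes "random_variable borel f" "\<And>\<omega>. \<omega> \<in> space M \<Longrightarrow> f \<omega> \<in> {a..b}"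
  shows "integrable M f"
proof -
  have "\<bar>f \<omega>\<bar> \<le> max \<bar>a\<bar> \<bar>b\<bar>" if "\<omega> \<in> space M" for \<omega>
    using assms(2)[OF that] by auto
  with assms(1) show ?thesis
    by (intro integrable_const_bound[where B = "max \<bar>a\<bar> \<bar>b\<bar>"] AE_I2) auto
qed

lemma (in prob_space) expectation_interval:
  fixes f :: "'a \<Rightarrow> real"
  assumes "random_variable borel f" "\<And>\<omega>. \<omega> \<in> space M \<Longrightarrow> f \<omega> \<in> {a..b}"
  shows "expectation f \<in> {a..b}"
  using integrable_interval[OF assms] assms(2)
  by (auto intro!: integral_ge_const integral_le_const AE_I2)

lemma (in prob_space) Hoeffding_expectation:
  fixes f :: "'a \<Rightarrow> real"
  assumes [measurable]: "random_variable borel f"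
    and bd: "\<And>\<omega>. \<omega> \<in> space M \<Longrightarrow> f \<omega> \<in> {a..b}" and "0 < s"
  shows "expectation (\<lambda>\<omega>. exp (s * (f \<omega> - expectation f))) \<le> exp (s\<^sup>2 * (b - a)\<^sup>2 / 8)"
proof -
  interpret I: interval_bounded_random_variable M f a b
    using bd by unfold_locales auto
  have "ennreal (expectation (\<lambda>\<omega>. exp (s * (f \<omega> - expectation f)))) =
      (\<integral>\<^sup>+\<omega>. ennreal (exp (s * (f \<omega> - expectation f))) \<partial>M)"
  proof (rule nn_integral_eq_integral[symmetric])
    show "integrable M (\<lambda>\<omega>. exp (s * (f \<omega> - expectation f)))"
      using bd \<open>0 < s\<close>
      by (intro integrable_interval[where a = 0 and b = "exp (s * (b - expectation f))"]) auto
  qed simp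
  also have "\<dots> \<le> ennreal (exp (s\<^sup>2 * (b - a)\<^sup>2 / 8))"
    using I.Hoeffdings_lemma_nn_integral[OF \<open>0 < s\<close>] .
  finally show ?thesis by simp
qed

text \<open>Since \<open>S\<close> and \<open>T\<close> are disjoint, at most one of them contains
  \<open>p\<close>; by symmetry let it not be \<open>T\<close>. Then \<open>v\<close> has no
  neighbour in \<open>T\<close>, so \<open>T\<close> is independent both of
  \<open>insert v S\<close> and of \<open>{v}\<close>. Dividing the first product formula by the
  probability of the condition gives the product formula under the conditional measure.\<close>

lemma (in prob_space) point_dependent_uniform_measure:
  fixes X :: "'v \<Rightarrow> 'a \<Rightarrow> real"
  assumes dep: "point_dependent M (insert v A) E X" and "v \<notin> A" and fin: "finite A"
    and rv: "\<And>i. i \<in> insert v A \<Longrightarrow> random_variable borel (X i)"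
    and p: "\<And>u. u \<in> A \<Longrightarrow> {u, v} \<in> E \<Longrightarrow> u = p"
    and pos: "prob {\<omega>\<in>space M. X v \<omega> = x} \<noteq> 0"
  shows "point_dependent (uniform_measure M {\<omega>\<in>space M. X v \<omega> = x}) A E X"
proof -
  let ?V = "{\<omega>\<in>space M. X v \<omega> = x}"
  have ev[measurable]: "{\<omega>\<in>space M. \<forall>i\<in>S. X i \<omega> = a i} \<in> events" if "S \<subseteq> insert v A" for S a
  proof -
    have "finite S" using that fin finite_subset by auto
    moreover have "{\<omega>\<in>space M. X i \<omega> = a i} \<in> events" if "i \<in> S" for i
    proof -
      have [measurable]: "random_variable borel (X i)"
        using rv \<open>S \<subseteq> insert v A\<close> that by blast
      show ?thesis by measurable
    qed
    ultimately show ?thesis by (intro sets.sets_Collect_finite_All) auto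
  qed
  have evV: "?V \<in> events" using ev[of "{v}" "\<lambda>_. x"] by simp
  have eV: "emeasure M ?V \<noteq> 0" using pos by (simp add: emeasure_eq_measure)
  have cond: "measure (uniform_measure M ?V) {\<omega>\<in>space M. \<forall>i\<in>S. X i \<omega> = a i}
      = prob {\<omega>\<in>space M. \<forall>i\<in>insert v S. X i \<omega> = (a(v := x)) i} / prob ?V" if "S \<subseteq> A" for S a
  proof -
    have "?V \<inter> {\<omega>\<in>space M. \<forall>i\<in>S. X i \<omega> = a i} = {\<omega>\<in>space M. \<forall>i\<in>insert v S. X i \<omega> = (a(v := x)) i}"
      using \<open>v \<notin> A\<close> that by auto
    moreover have "measure (uniform_measure M ?V) {\<omega>\<in>space M. \<forall>i\<in>S. X i \<omega> = a i}
        = prob (?V \<inter> {\<omega>\<in>space M. \<forall>i\<in>S. X i \<omega> = a i}) / prob ?V"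
      by (intro measure_uniform_measure eV ev subset_insertI2 that) (simp add: emeasure_eq_measure)
    ultimately show ?thesis by simp
  qed
  have main: "point_indep (uniform_measure M ?V) X S T"
    if ST: "S \<subseteq> A" "T \<subseteq> A" "S \<inter> T = {}" "\<forall>u\<in>S. \<forall>w\<in>T. {u, w} \<notin> E" and pT: "p \<notin> T" for S T
  proof -
    have adj: "{v, w} \<notin> E" if "w \<in> T" for w
      using p[of w] pT that ST by (auto simp: insert_commute)
    show ?thesis unfolding point_indep_def
    proof (intro allI)
      fix a
      let ?a = "a(v := x)"
      let ?P = "\<lambda>S. prob {\<omega>\<in>space M. \<forall>i\<in>S. X i \<omega> = ?a i}"
      have *: "point_indep M X S' T" if "S' \<subseteq> insert v S" for S'
      proof -
        have "S' \<subseteq> insert v A" "T \<subseteq> insert v A" "S' \<inter> T = {}" "\<forall>u\<in>S'. \<forall>w\<in>T. {u, w} \<notin> E"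
          using ST adj \<open>v \<notin> A\<close> that by auto
        then show ?thesis using dep unfolding point_dependent_def by simp
      qed
      have "point_indep M X (insert v S) T" "point_indep M X {v} T"
        by (rule *; simp)+
      note e = this[unfolded point_indep_def, THEN spec[of _ ?a]]
      have e1: "?P (insert v (S \<union> T)) = ?P (insert v S) * ?P T"
        using e(1) unfolding Un_insert_left .
      have "?P {v} = prob ?V" by simp
      then have e2: "?P (insert v T) = prob ?V * ?P T"
        using e(2) unfolding Un_insert_left Un_empty_left by simp
      have "prob ?V \<noteq> 0" using pos .
      then have "?P (insert v (S \<union> T)) / prob ?V = (?P (insert v S) / prob ?V) * (?P (insert v T) / prob ?V)"
        unfolding e1 e2 by simp
      then show "measure (uniform_measure M ?V) {\<omega> \<in> space (uniform_measure M ?V). \<forall>i\<in>S \<union> T. X i \<omega> = a i} =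
        measure (uniform_measure M ?V) {\<omega> \<in> space (uniform_measure M ?V). \<forall>i\<in>S. X i \<omega> = a i} *
        measure (uniform_measure M ?V) {\<omega> \<in> space (uniform_measure M ?V). \<forall>i\<in>T. X i \<omega> = a i}"
        by (simp only: space_uniform_measure cond[OF ST(1), of a] cond[OF ST(2), of a]
            cond[OF Un_least[OF ST(1,2)], of a])
    qed
  qed
  show ?thesis
    unfolding point_dependent_def
  proof (intro allI impI)
    fix S T assume ST: "S \<subseteq> A" "T \<subseteq> A" "S \<inter> T = {}" "\<forall>u\<in>S. \<forall>w\<in>T. {u, w} \<notin> E"
    show "point_indep (uniform_measure M ?V) X S T"
    proof (cases "p \<in> T")
      case True
      have "{u, w} \<notin> E" if "u \<in> T" "w \<in> S" for u w
      proof -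
        have "{w, u} \<notin> E" using ST(4) that by blast
        then show ?thesis by (subst insert_commute)
      qed
      then have "point_indep (uniform_measure M ?V) X T S"
        using ST True by (intro main) auto
      then show ?thesis by (simp add: point_indep_sym)
    qed (use main ST in blast)
  qed
qed

text \<open>Independence leaves every point mass of \<open>X i\<close> unchanged by the
  conditioning, and with finite range the point masses determine the mean.\<close>

lemma (in prob_space) conditional_expectation_eq:
  fixes X :: "'v \<Rightarrow> 'a \<Rightarrow> real"
  assumes ind: "point_indep M X {v} {i}" and vi: "v \<noteq> i"
    and rv[measurable]: "random_variable borel (X v)" "random_variable borel (X i)"
    and fin: "finite (X i ` space M)"
    and int: "integrable M (X i)"
    and pos: "prob {\<omega>\<in>space M. X v \<omega> = x} \<noteq> 0"
  shows "(\<integral>\<omega>. X i \<omega> \<partial>uniform_measure M {\<omega>\<in>space M. X v \<omega> = x}) = expectation (X i)"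
proof -
  let ?V = "{\<omega>\<in>space M. X v \<omega> = x}"
  let ?U = "uniform_measure M ?V"
  have eV: "emeasure M ?V \<noteq> 0" "emeasure M ?V < \<infinity>" using pos by (auto simp: emeasure_eq_measure)
  interpret U: prob_space ?U
    by (rule prob_space_uniform_measure) (use eV in auto)
  have intU: "integrable ?U (X i)"
    by (rule U.integrable_const_bound[where B = "Max ((\<lambda>\<omega>. \<bar>X i \<omega>\<bar>) ` space M)"])
      (use finite_imageI[OF fin, of abs] in \<open>auto intro!: AE_I2 Max_ge simp: image_image\<close>)
  have "measure ?U {\<omega>\<in>space M. X i \<omega> = y} = prob {\<omega>\<in>space M. X i \<omega> = y}" for y
  proof -
    have "prob {\<omega>\<in>space M. \<forall>j\<in>{v} \<union> {i}. X j \<omega> = ((\<lambda>_. y)(v := x)) j} =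
        prob {\<omega>\<in>space M. \<forall>j\<in>{v}. X j \<omega> = ((\<lambda>_. y)(v := x)) j} *
        prob {\<omega>\<in>space M. \<forall>j\<in>{i}. X j \<omega> = ((\<lambda>_. y)(v := x)) j}"
      using ind unfolding point_indep_def by (rule spec)
    moreover have "{\<omega>\<in>space M. \<forall>j\<in>{v} \<union> {i}. X j \<omega> = ((\<lambda>_. y)(v := x)) j} =
        ?V \<inter> {\<omega>\<in>space M. X i \<omega> = y}"
      using vi by auto
    ultimately have "prob (?V \<inter> {\<omega>\<in>space M. X i \<omega> = y}) = prob ?V * prob {\<omega>\<in>space M. X i \<omega> = y}"
      using vi by simp
    then show ?thesis using pos eV by (subst measure_uniform_measure) auto
  qed
  then show ?thesis
    using U.expectation_finite_range[of "X i" "\<lambda>x. x"] expectation_finite_range[of "X i" "\<lambda>x. x"]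
      fin int intU by simp
qed

text \<open>The inductive step. On the event that \<open>X v\<close> equals \<open>x\<close>, the
  centred sum is a constant depending on \<open>x\<close> plus the sum over \<open>A\<close> centred
  at its conditional means. The hypothesis bounds the conditional moment generating function of the
  latter by the same \<open>K\<close> for every \<open>x\<close>; what remains is a centred bounded
  function of \<open>X v\<close> alone, to which Hoeffding's lemma applies.\<close>

lemma (in prob_space) mgf_insert:
  fixes X :: "'v \<Rightarrow> 'a \<Rightarrow> real"
  assumes dep: "point_dependent M (insert v A) E X" and vA: "v \<notin> A" and fin: "finite A"
    and rv: "\<And>i. i \<in> insert v A \<Longrightarrow> random_variable borel (X i)"
    and fr: "\<And>i. i \<in> insert v A \<Longrightarrow> finite (X i ` space M)"
    and bd: "\<And>i \<omega>. i \<in> insert v A \<Longrightarrow> \<omega> \<in> space M \<Longrightarrow> X i \<omega> \<in> {a i..a i + c i}"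
    and N: "N = {u\<in>A. {u, v} \<in> E}" and p: "N \<subseteq> {p}"
    and s: "0 < s"
    and IH: "\<And>U :: 'a measure. prob_space U \<Longrightarrow> sets U = sets M \<Longrightarrow> point_dependent U A E X \<Longrightarrow>
        (\<integral>\<omega>. exp (s * (\<Sum>i\<in>A. X i \<omega> - integral\<^sup>L U (X i))) \<partial>U) \<le> K"
  shows "expectation (\<lambda>\<omega>. exp (s * (\<Sum>i\<in>insert v A. X i \<omega> - expectation (X i))))
      \<le> exp (s\<^sup>2 * (c v + (\<Sum>i\<in>N. c i))\<^sup>2 / 8) * K"
proof -
  have [measurable]: "random_variable borel (X v)" and rvA: "\<And>i. i \<in> A \<Longrightarrow> random_variable borel (X i)"
    using rv by auto
  note [measurable] = rvA
  have NA: "N \<subseteq> A" and finN: "finite N" using N fin by auto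
  define V where "V x = {\<omega>\<in>space M. X v \<omega> = x}" for x
  have [measurable]: "V x \<in> events" for x unfolding V_def by measurable
  define U where "U x = uniform_measure M (V x)" for x
  \<comment> \<open>Conditioning on a null event yields no probability measure. The unconditional
    mean is the default there, so that the interval bound and the equality outside \<open>N\<close>
    hold for every \<open>x\<close>.\<close>
  define m where "m x i = (if prob (V x) = 0 then expectation (X i) else integral\<^sup>L (U x) (X i))" for x i
  have UP: "prob_space (U x)" if "prob (V x) \<noteq> 0" for x
    unfolding U_def using that by (intro prob_space_uniform_measure) (auto simp: emeasure_eq_measure)
  have spU[simp]: "space (U x) = space M" "sets (U x) = sets M" for x
    by (auto simp: U_def)
  have intX: "integrable M (X i)" if "i \<in> insert v A" for i
    using integrable_interval[OF rv bd] that by blast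
  have m_int: "m x i \<in> {a i..a i + c i}" if "i \<in> A" for x i
  proof (cases "prob (V x) = 0")
    case True then show ?thesis
      using expectation_interval[OF rv bd, of i] that by (simp add: m_def)
  next
    case False
    interpret U: prob_space "U x" using UP[OF False] .
    have "integral\<^sup>L (U x) (X i) \<in> {a i..a i + c i}"
      using rv[of i] bd that by (intro U.expectation_interval) (auto cong: measurable_cong_sets)
    then show ?thesis using False by (simp add: m_def)
  qed
  have m_eq: "m x i = expectation (X i)" if "i \<in> A - N" for x i
  proof (cases "prob (V x) = 0")
    case False
    have "point_indep M X {v} {i}"
    proof -
      have "{i, v} \<notin> E" using that N by auto
      then have "\<forall>u\<in>{v}. \<forall>w\<in>{i}. {u, w} \<notin> E" by (simp add: insert_commute)
      moreover have "{v} \<subseteq> insert v A" "{i} \<subseteq> insert v A" "{v} \<inter> {i} = {}" using that vA by auto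
      ultimately show ?thesis using dep unfolding point_dependent_def by simp
    qed
    moreover have "v \<noteq> i" "i \<in> insert v A" using that vA by auto
    ultimately show ?thesis
      using conditional_expectation_eq[of X v i x] rv fr intX False
      by (simp add: m_def U_def V_def)
  qed (simp add: m_def)
  \<comment> \<open>\<open>h (X v) - \<mu>\<close> is the martingale increment of revealing \<open>X v\<close>.\<close>
  define h where "h x = x + (\<Sum>i\<in>N. m x i)" for x
  define \<mu> where "\<mu> = expectation (X v) + (\<Sum>i\<in>N. expectation (X i))"
  let ?H = "\<lambda>\<omega>. h (X v \<omega>)"
  have finv: "finite (X v ` space M)" using fr by simp
  \<comment> \<open>Nothing is known about the regularity of \<open>m\<close> in \<open>x\<close>.
    Measurability of its composition with \<open>X v\<close> comes from the finite range: any
    function of a simple function is simple.\<close>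
  have sf: "simple_function M (X v)"
    by (rule simple_function_borel_measurable) (use finv in auto)
  then have rvm: "random_variable borel (\<lambda>\<omega>. g (X v \<omega>))" for g :: "real \<Rightarrow> real"
    using borel_measurable_simple_function[OF simple_function_compose1[OF sf, of g]] by simp
  \<comment> \<open>Conditional means of neighbours stay in the neighbours' own intervals, so the
    interval widens from \<open>c v\<close> by exactly the sum of their lengths.\<close>
  have H_bd: "?H \<omega> \<in> {a v + (\<Sum>i\<in>N. a i)..a v + (\<Sum>i\<in>N. a i) + (c v + (\<Sum>i\<in>N. c i))}"
    if "\<omega> \<in> space M" for \<omega>
  proof -
    have "(\<Sum>i\<in>N. a i) \<le> (\<Sum>i\<in>N. m (X v \<omega>) i)" "(\<Sum>i\<in>N. m (X v \<omega>) i) \<le> (\<Sum>i\<in>N. a i + c i)"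
      using m_int NA by (auto intro!: sum_mono)
    then show ?thesis using bd[of v \<omega>] that by (simp add: h_def sum.distrib)
  qed
  have mint: "integrable M (\<lambda>\<omega>. m (X v \<omega>) i)" if "i \<in> A" for i
    using m_int[OF that] by (intro integrable_interval[OF rvm])
  \<comment> \<open>Tower property, cell by cell. Cells of probability 0 contribute nothing to
    either side, whatever the default of \<open>m\<close> is.\<close>
  have Em: "expectation (\<lambda>\<omega>. m (X v \<omega>) i) = expectation (X i)" if "i \<in> N" for i
  proof -
    have iA: "i \<in> A" using that NA by auto
    have "m x i * prob (V x) = (\<integral>\<omega>. indicator (V x) \<omega> * X i \<omega> \<partial>M)" for x
    proof (cases "prob (V x) = 0")
      case True
      then have "AE \<omega> in M. \<omega> \<notin> V x" by (simp add: AE_iff_measurable[OF _ refl] prob_eq_0)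
      then have "(\<integral>\<omega>. indicator (V x) \<omega> * X i \<omega> \<partial>M) = (\<integral>\<omega>. 0 \<partial>M)"
        using iA by (intro integral_cong_AE) auto
      then show ?thesis using True by simp
    next
      case False
      then show ?thesis
        using iA by (simp add: m_def U_def integral_uniform_measure)
    qed
    then show ?thesis
      using expectation_finite_range[of "X v" "\<lambda>x. m x i"] expectation_split[of "X v" "X i"]
        finv mint iA intX by (simp add: V_def)
  qed
  have EH: "expectation ?H = \<mu>"
  proof -
    have "expectation ?H = expectation (X v) + (\<integral>\<omega>. (\<Sum>i\<in>N. m (X v \<omega>) i) \<partial>M)"
      unfolding h_def by (rule Bochner_Integration.integral_add)
        (auto intro!: intX Bochner_Integration.integrable_sum mint subsetD[OF NA])
    also have "(\<integral>\<omega>. (\<Sum>i\<in>N. m (X v \<omega>) i) \<partial>M) = (\<Sum>i\<in>N. \<integral>\<omega>. m (X v \<omega>) i \<partial>M)"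
      by (rule Bochner_Integration.integral_sum) (rule mint[OF subsetD[OF NA]])
    finally show ?thesis unfolding \<mu>_def using Em by simp
  qed
  let ?F = "\<lambda>\<omega>. exp (s * (\<Sum>i\<in>insert v A. X i \<omega> - expectation (X i)))"
  let ?G = "\<lambda>\<omega>. exp (s * (?H \<omega> - \<mu>))"
  \<comment> \<open>Recentring \<open>A\<close> at the conditional means changes only the terms in
    \<open>N\<close>, and these are the ones absorbed by \<open>h\<close> and
    \<open>\<mu>\<close>.\<close>
  have split: "(\<Sum>i\<in>insert v A. X i \<omega> - expectation (X i)) =
      (h (X v \<omega>) - \<mu>) + (\<Sum>i\<in>A. X i \<omega> - m (X v \<omega>) i)" for \<omega>
  proof -
    have "(\<Sum>i\<in>A. m (X v \<omega>) i - expectation (X i)) = (\<Sum>i\<in>N. m (X v \<omega>) i - expectation (X i))"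
      using m_eq fin NA by (intro sum.mono_neutral_right) auto
    then show ?thesis using vA fin by (simp add: h_def \<mu>_def sum_subtractf)
  qed
  have Fint: "integrable M ?F"
  proof (rule integrable_interval[where a = 0])
    fix \<omega> assume "\<omega> \<in> space M"
    then have "X i \<omega> \<le> a i + c i" if "i \<in> insert v A" for i using bd that by auto
    then show "?F \<omega> \<in> {0..exp (s * (\<Sum>i\<in>insert v A. a i + c i - expectation (X i)))}"
      using s by (auto intro!: sum_mono simp del: sum.insert)
  qed (use rv in simp)
  have Gint: "integrable M ?G"
    using s by (intro integrable_interval[where a = 0 and
       b = "exp (s * (a v + (\<Sum>i\<in>N. a i) + (c v + (\<Sum>i\<in>N. c i)) - \<mu>))"] rvm) (auto dest!: H_bd)
  have cell: "(\<integral>\<omega>. indicator (V x) \<omega> * ?F \<omega> \<partial>M) \<le> exp (s * (h x - \<mu>)) * K * prob (V x)" for x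
  proof (cases "prob (V x) = 0")
    case True
    then have "AE \<omega> in M. \<omega> \<notin> V x" by (simp add: AE_iff_measurable[OF _ refl] prob_eq_0)
    then have "(\<integral>\<omega>. indicator (V x) \<omega> * ?F \<omega> \<partial>M) = (\<integral>\<omega>. 0 \<partial>M)"
      using rv by (intro integral_cong_AE) auto
    then show ?thesis using True by simp
  next
    case False
    have dU: "point_dependent (U x) A E X"
      unfolding U_def V_def
      by (rule point_dependent_uniform_measure[OF dep vA fin rv, where p = p])
        (use p N False in \<open>auto simp: V_def\<close>)
    have "(\<integral>\<omega>. indicator (V x) \<omega> * ?F \<omega> \<partial>M) = (\<integral>\<omega>. ?F \<omega> \<partial>U x) * prob (V x)"
      using False rv unfolding U_def by (subst integral_uniform_measure) auto
    also have "(\<integral>\<omega>. ?F \<omega> \<partial>U x) =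
        (\<integral>\<omega>. exp (s * (h x - \<mu>)) * exp (s * (\<Sum>i\<in>A. X i \<omega> - integral\<^sup>L (U x) (X i))) \<partial>U x)"
    proof (rule integral_cong_AE)
      have "AE \<omega> in U x. \<omega> \<in> V x" unfolding U_def by (rule AE_uniform_measureI) auto
      then show "AE \<omega> in U x. ?F \<omega> =
          exp (s * (h x - \<mu>)) * exp (s * (\<Sum>i\<in>A. X i \<omega> - integral\<^sup>L (U x) (X i)))"
      proof eventually_elim
        case (elim \<omega>)
        then have "X v \<omega> = x" by (simp add: V_def)
        then show ?case
          using False unfolding split by (simp add: m_def ring_distribs exp_add)
      qed
    qed (use rv in \<open>auto cong: measurable_cong_sets\<close>)
    also have "\<dots> = exp (s * (h x - \<mu>)) * (\<integral>\<omega>. exp (s * (\<Sum>i\<in>A. X i \<omega> - integral\<^sup>L (U x) (X i))) \<partial>U x)"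
      by simp
    also have "\<dots> \<le> exp (s * (h x - \<mu>)) * K"
      using IH[OF UP[OF False] _ dU] by (intro mult_left_mono) auto
    finally show ?thesis by (simp add: mult_right_mono)
  qed
  \<comment> \<open>The sign of \<open>K\<close> is needed to multiply Hoeffding's bound by it. Cell
    probabilities sum to 1, so some cell has positive probability, and there \<open>K\<close> bounds
    the integral of an exponential.\<close>
  have Kpos: "0 \<le> K"
  proof -
    obtain x where "prob (V x) \<noteq> 0"
      using expectation_finite_range[of "X v" "\<lambda>_. 1"] finv by (force simp: V_def prob_space)
    note x = this
    have dU: "point_dependent (U x) A E X"
      unfolding U_def V_def
      by (rule point_dependent_uniform_measure[OF dep vA fin rv, where p = p])
        (use p N x in \<open>auto simp: V_def\<close>)
    have "0 \<le> (\<integral>\<omega>. exp (s * (\<Sum>i\<in>A. X i \<omega> - integral\<^sup>L (U x) (X i))) \<partial>U x)" by simp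
    also have "\<dots> \<le> K" using IH[OF UP[OF x] _ dU] by simp
    finally show ?thesis .
  qed
  have "expectation ?F = (\<Sum>x\<in>X v ` space M. \<integral>\<omega>. indicator (V x) \<omega> * ?F \<omega> \<partial>M)"
    unfolding V_def by (rule expectation_split) (use finv Fint in auto)
  also have "\<dots> \<le> (\<Sum>x\<in>X v ` space M. exp (s * (h x - \<mu>)) * K * prob (V x))"
    by (intro sum_mono cell)
  also have "\<dots> = K * expectation ?G"
    using expectation_finite_range[of "X v" "\<lambda>x. exp (s * (h x - \<mu>))"] finv Gint
    by (simp add: V_def sum_distrib_left mult_ac)
  also have "\<dots> \<le> K * exp (s\<^sup>2 * (c v + (\<Sum>i\<in>N. c i))\<^sup>2 / 8)"
    using Hoeffding_expectation[of ?H, OF rvm H_bd s] Kpos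
    by (intro mult_left_mono) (simp_all add: EH)
  finally show ?thesis by (simp add: mult.commute)
qed

subsection \<open>Elimination orders of forests\<close>

text \<open>
  The sum over \<open>N\<close> is \<open>c p\<close> if \<open>v\<close> has a neighbour \<open>p\<close> in \<open>A\<close>, and \<open>0\<close> if \<open>v\<close> is isolated.
\<close>

inductive elimination :: "'v set set \<Rightarrow> ('v \<Rightarrow> real) \<Rightarrow> 'v set \<Rightarrow> real \<Rightarrow> bool" for E c where
  empty: "elimination E c {} 0"
| insert: "elimination E c A B \<Longrightarrow> v \<notin> A \<Longrightarrow> N = {u\<in>A. {u, v} \<in> E} \<Longrightarrow> N \<subseteq> {p} \<Longrightarrow>
     elimination E c (insert v A) (B + (c v + (\<Sum>u\<in>N. c u))\<^sup>2)"

lemma elimination_finite: "elimination E c A B \<Longrightarrow> finite A"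
  by (induction rule: elimination.induct) auto

text \<open>A walk is kept free of repetitions by cutting it back whenever the next vertex already
  lies on it. The last conjunct is kept because it later shows that a cycle built from the path
  stays in one component.\<close>

lemma rtrancl_distinct_path:
  assumes "(x, y) \<in> r\<^sup>*"
  shows "\<exists>xs. xs \<noteq> [] \<and> hd xs = x \<and> last xs = y \<and> distinct xs \<and>
           successively (\<lambda>u v. (u, v) \<in> r) xs \<and> (\<forall>z\<in>set xs. (x, z) \<in> r\<^sup>*)"
  using assms
proof (induction rule: rtrancl_induct)
  case base
  show ?case by (rule exI[of _ "[x]"]) auto
next
  case (step y z)
  then obtain xs where xs: "xs \<noteq> []" "hd xs = x" "last xs = y" "distinct xs"
      "successively (\<lambda>u v. (u, v) \<in> r) xs" "\<forall>z\<in>set xs. (x, z) \<in> r\<^sup>*" by blast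
  show ?case
  proof (cases "z \<in> set xs")
    case True
    then obtain us vs where "xs = us @ z # vs" by (auto simp: in_set_conv_decomp)
    then show ?thesis using xs
      by (intro exI[of _ "us @ [z]"]) (auto simp: successively_append_iff hd_append split: if_splits)
  next
    case False
    then show ?thesis using xs step
      by (intro exI[of _ "xs @ [z]"]) (auto simp: successively_append_iff)
  qed
qed

section \<open>Reachability, and cycles inside a component\<close>

lemma reachable_refl: "reachable E u u"
  by (simp add: reachable_def)

lemma reachable_trans: "reachable E u v \<Longrightarrow> reachable E v w \<Longrightarrow> reachable E u w"
  by (auto simp: reachable_def)

lemma reachable_edge: "{u, v} \<in> E \<Longrightarrow> reachable E u v"
  by (auto simp: reachable_def)

lemma reachable_sym: "reachable E u v \<longleftrightarrow> reachable E v u"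
proof -
  have "sym {(x, y). {x, y} \<in> E}" by (auto simp: sym_def insert_commute)
  then show ?thesis unfolding reachable_def using sym_rtrancl by (metis symD)
qed

lemma reachable_mono:
  assumes "E \<subseteq> E'" "reachable E u v" shows "reachable E' u v"
proof -
  have "{(x, y). {x, y} \<in> E} \<subseteq> {(x, y). {x, y} \<in> E'}" using assms(1) by auto
  from rtrancl_mono[OF this] show ?thesis using assms(2) by (auto simp: reachable_def)
qed

lemma reachable_exit:
  assumes "reachable E u v" "u \<in> A" "v \<notin> A"
  obtains a b where "a \<in> A" "b \<notin> A" "{a, b} \<in> E"
proof -
  have "(u, v) \<in> {(x, y). {x, y} \<in> E}\<^sup>* \<Longrightarrow> v \<notin> A \<Longrightarrow> \<exists>a b. a \<in> A \<and> b \<notin> A \<and> {a, b} \<in> E"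
    by (induction rule: rtrancl_induct) (use \<open>u \<in> A\<close> in auto)
  then show ?thesis using assms that by (auto simp: reachable_def)
qed

lemma reachable_closed:
  assumes "reachable E u v" "u \<in> A" "\<And>e. e \<in> E \<Longrightarrow> e \<subseteq> A"
  shows "v \<in> A"
proof (rule ccontr)
  assume "v \<notin> A"
  then obtain a b where "a \<in> A" "b \<notin> A" "{a, b} \<in> E" using assms reachable_exit by metis
  then show False using assms(3) by blast
qed

text \<open>A path inside \<open>A\<close> from \<open>a\<close> to \<open>b\<close>, closed through
  the outside vertex \<open>w\<close>, is a cycle: \<open>w\<close> is new because the path never
  leaves \<open>A\<close>, and the length is at least 3 because \<open>a\<close> and
  \<open>b\<close> differ.\<close>

lemma graph_cycle_close_path:
  assumes reach: "reachable (induced_edges E A) a b" and "a \<in> A" and "a \<noteq> b" and "w \<notin> A"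
    and edges: "{a, w} \<in> E" "{b, w} \<in> E"
  obtains p where "graph_cycle E p" "\<And>z. z \<in> set p \<Longrightarrow> reachable E a z"
proof -
  let ?r = "{(x, y). {x, y} \<in> induced_edges E A}"
  obtain xs where xs: "xs \<noteq> []" "hd xs = a" "last xs = b" "distinct xs"
      "successively (\<lambda>u v. (u, v) \<in> ?r) xs" "\<forall>z\<in>set xs. (a, z) \<in> ?r\<^sup>*"
    using rtrancl_distinct_path[OF reach[unfolded reachable_def]] by blast
  have sub: "induced_edges E A \<subseteq> E" by (auto simp: induced_edges_def)
  have reach_xs: "reachable (induced_edges E A) a z" if "z \<in> set xs" for z
    using xs(6) that by (simp add: reachable_def)
  have xsA: "set xs \<subseteq> A"
  proof
    fix z assume "z \<in> set xs"
    then show "z \<in> A"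
      using reachable_closed[OF reach_xs \<open>a \<in> A\<close>] by (auto simp: induced_edges_def)
  qed
  let ?p = "xs @ [w]"
  have len: "2 \<le> length xs"
    using xs(1-3) \<open>a \<noteq> b\<close> by (cases xs; cases "tl xs") auto
  have step: "{xs ! i, xs ! Suc i} \<in> E" if "Suc i < length xs" for i
    using xs(5) that sub by (auto simp: successively_conv_nth)
  have "{?p ! i, ?p ! (Suc i mod length ?p)} \<in> E" if il: "i < length ?p" for i
  proof -
    \<comment> \<open>The cases are an edge of the path, the edge from \<open>b\<close> to
      \<open>w\<close>, and the edge from \<open>w\<close> to \<open>a\<close>, where the index
      wraps around to 0.\<close>
    consider "Suc i < length xs" | "Suc i = length xs" | "i = length xs"
      using il by (cases "Suc i" "length xs" rule: linorder_cases) auto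
    then show ?thesis
    proof cases
      case 1
      then show ?thesis using step by (simp add: nth_append)
    next
      case 2
      then have "xs ! i = b" using xs by (metis diff_Suc_1 last_conv_nth)
      then show ?thesis using 2 edges by (simp add: nth_append)
    next
      case 3
      have "xs ! 0 = a" using xs by (simp add: hd_conv_nth)
      then show ?thesis using 3 edges xs(1) by (simp add: nth_append insert_commute)
    qed
  qed
  then have "graph_cycle E ?p"
    using xs(4) xsA \<open>w \<notin> A\<close> len by (auto simp: graph_cycle_def)
  moreover have "reachable E a z" if "z \<in> set ?p" for z
    using that reach_xs reachable_mono[OF sub] reachable_edge[OF edges(1)] by auto
  ultimately show thesis using that by blast
qed

lemma components_eq:
  "components F E = (\<lambda>v. {u\<in>F. reachable E v u}) ` F"
  by (auto simp: components_def quotient_def)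

text \<open>\<open>is_forest\<close> excludes cycles only within the single components. A cycle
  whose vertices are all reachable from \<open>a\<close> lies entirely in the component of
  \<open>a\<close>, which is a tree.\<close>

lemma is_forest_no_cycle:
  assumes forest: "is_forest F E" and "a \<in> F" and E: "\<And>e. e \<in> E \<Longrightarrow> e \<subseteq> F"
    and p: "\<And>z. z \<in> set p \<Longrightarrow> reachable E a z"
  shows "\<not> graph_cycle E p"
proof
  assume cyc: "graph_cycle E p"
  let ?T = "{u\<in>F. reachable E a u}"
  have "set p \<subseteq> ?T"
    using reachable_closed[OF p \<open>a \<in> F\<close>] E p by auto
  have "graph_cycle (induced_edges E ?T) p"
    unfolding graph_cycle_def
  proof (intro conjI allI impI)
    fix i assume i: "i < length p"
    then have "Suc i mod length p < length p" by (intro mod_less_divisor) auto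
    then have "{p ! i, p ! (Suc i mod length p)} \<subseteq> ?T"
      using \<open>set p \<subseteq> ?T\<close> i nth_mem by blast
    then show "{p ! i, p ! (Suc i mod length p)} \<in> induced_edges E ?T"
      using cyc i by (auto simp: graph_cycle_def induced_edges_def)
  qed (use cyc in \<open>auto simp: graph_cycle_def\<close>)
  moreover have "is_tree ?T (induced_edges E ?T)"
    using forest \<open>a \<in> F\<close> by (auto simp: is_forest_def components_eq)
  ultimately show False by (auto simp: is_tree_def)
qed

section \<open>Cost of a forest and an elimination order that realises it\<close>

definition forest_bound :: "'v set set \<Rightarrow> ('v \<Rightarrow> real) \<Rightarrow> 'v set \<Rightarrow> real" where
  "forest_bound E c F = (\<Sum>e\<in>induced_edges E F. (\<Sum>i\<in>e. c i)\<^sup>2)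
     + (\<Sum>T\<in>components F (induced_edges E F). (Min (c ` T))\<^sup>2)"

text \<open>Edges have exactly two end points, so the edges gained are those joining
  \<open>v\<close> to a vertex of \<open>N\<close>. For empty \<open>N\<close> nothing is gained
  here, whereas \<open>elimination\<close> still charges the square of \<open>c v\<close>.\<close>

lemma sum_induced_edges_insert:
  assumes graph: "simple_graph V E" and A: "A \<subseteq> V" "v \<notin> A"
    and N: "N = {u\<in>A. {u, v} \<in> E}" "N \<subseteq> {p}"
  shows "(\<Sum>e\<in>induced_edges E (insert v A). (\<Sum>i\<in>e. c i)\<^sup>2) =
     (\<Sum>e\<in>induced_edges E A. (\<Sum>i\<in>e. c i)\<^sup>2) + (\<Sum>u\<in>N. (c v + c u)\<^sup>2 :: real)"
proof -
  have eq: "induced_edges E (insert v A) = induced_edges E A \<union> (\<lambda>u. {u, v}) ` N"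
  proof (intro equalityI subsetI)
    fix e assume e: "e \<in> induced_edges E (insert v A)"
    show "e \<in> induced_edges E A \<union> (\<lambda>u. {u, v}) ` N"
    proof (cases "v \<in> e")
      case True
      have "card e = 2" using e graph by (auto simp: induced_edges_def simple_graph_def)
      then obtain u where "e = {u, v}" "u \<noteq> v" using True by (auto simp: card_2_iff)
      then show ?thesis using e N by (auto simp: induced_edges_def)
    qed (use e in \<open>auto simp: induced_edges_def\<close>)
  qed (auto simp: induced_edges_def N)
  have "finite V" using graph by (simp add: simple_graph_def)
  then have fin: "finite (induced_edges E A)" "finite N"
    using A N finite_subset[of A V] finite_subset[of "induced_edges E A" "Pow A"]
    by (auto simp: induced_edges_def)
  have "(\<Sum>e\<in>(\<lambda>u. {u, v}) ` N. (\<Sum>i\<in>e. c i)\<^sup>2) = (\<Sum>u\<in>N. (c v + c u)\<^sup>2)"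
  proof (subst sum.reindex)
    show "inj_on (\<lambda>u. {u, v}) N" using N by (auto simp: inj_on_def)
    show "sum ((\<lambda>e. (\<Sum>i\<in>e. c i)\<^sup>2) \<circ> (\<lambda>u. {u, v})) N = (\<Sum>u\<in>N. (c v + c u)\<^sup>2)"
      using N A by (intro sum.cong) (auto simp: add.commute sum.insert_if)
  qed
  moreover have "induced_edges E A \<inter> (\<lambda>u. {u, v}) ` N = {}"
    using A by (auto simp: induced_edges_def)
  ultimately show ?thesis unfolding eq using fin by (simp add: sum.union_disjoint)
qed

text \<open>Each edge is charged once, when its second end point enters, and each root is charged
  the squared minimum of its tree. These charges add up to \<open>forest_bound\<close> with
  equality.\<close>

lemma forest_elimination:
  assumes graph: "simple_graph V E" and FV: "F \<subseteq> V" and forest: "is_forest F (induced_edges E F)"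
  shows "elimination E c F (forest_bound E c F)"
proof -
  let ?E = "induced_edges E F"
  have "finite F" using graph FV finite_subset by (auto simp: simple_graph_def)
  define comp where "comp v = {u\<in>F. reachable ?E v u}" for v
  define r where "r T = (SOME i. i \<in> T \<and> c i = Min (c ` T))" for T
  have comps: "components F ?E = comp ` F" by (simp add: components_eq comp_def)
  have comp_eq: "comp u = comp v" if "reachable ?E u v" for u v
    using that reachable_trans reachable_sym unfolding comp_def by (metis (lifting))
  have r: "r (comp v) \<in> comp v \<and> c (r (comp v)) = Min (c ` comp v)" if "v \<in> F" for v
    unfolding r_def
  proof (rule someI_ex)
    have "v \<in> comp v" "finite (comp v)"
      using that \<open>finite F\<close> by (auto simp: comp_def reachable_refl)
    then have "Min (c ` comp v) \<in> c ` comp v" by (intro Min_in) auto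
    then show "\<exists>i. i \<in> comp v \<and> c i = Min (c ` comp v)" by auto
  qed
  have r_comp: "comp (r (comp v)) = comp v" if "v \<in> F" for v
    using r[OF that] comp_eq[of v "r (comp v)"] by (auto simp: comp_def)
  have r_F: "r (comp v) \<in> F" if "v \<in> F" for v
    using r[OF that] by (simp add: comp_def)
  define R where "R = r ` components F ?E"
  have R_root: "r (comp v) = v" if "v \<in> R" for v
    using that r_comp by (auto simp: R_def comps)
  have "finite R" using \<open>finite F\<close> by (simp add: R_def comps)
  \<comment> \<open>Grow \<open>A\<close> outwards from one root of minimal \<open>c\<close> per tree; a second neighbour in \<open>A\<close> of a new
    vertex would close a cycle.\<close>
  define good where "good A \<longleftrightarrow> A \<subseteq> F \<and>
     elimination E c A ((\<Sum>e\<in>induced_edges E A. (\<Sum>i\<in>e. c i)\<^sup>2) + (\<Sum>i\<in>R \<inter> A. (c i)\<^sup>2)) \<and>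
     (\<forall>v\<in>A. r (comp v) \<in> A \<and> reachable (induced_edges E A) (r (comp v)) v)" for A
  have "\<exists>A. good A \<and> card A = n" if "n \<le> card F" for n
    using that
  proof (induction n)
    case 0
    have "induced_edges E {} = {}"
      using graph by (auto simp: induced_edges_def simple_graph_def)
    then show ?case by (intro exI[of _ "{}"]) (auto simp: good_def elimination.empty)
  next
    case (Suc n)
    then obtain A where A: "good A" "card A = n" by auto
    then have AF: "A \<subseteq> F" and elim: "elimination E c A
        ((\<Sum>e\<in>induced_edges E A. (\<Sum>i\<in>e. c i)\<^sup>2) + (\<Sum>i\<in>R \<inter> A. (c i)\<^sup>2))"
      and reach: "\<And>v. v \<in> A \<Longrightarrow> r (comp v) \<in> A" "\<And>v. v \<in> A \<Longrightarrow> reachable (induced_edges E A) (r (comp v)) v"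
      by (auto simp: good_def)
    have finA: "finite A" using AF \<open>finite F\<close> finite_subset by auto
    have mono: "reachable ?E u v" if "reachable (induced_edges E A) u v" for u v
      using that AF by (intro reachable_mono[OF _ that]) (auto simp: induced_edges_def)
    have edge: "comp u = comp v" if "u \<in> A" "v \<in> F" "{u, v} \<in> E" for u v
      using that AF by (intro comp_eq reachable_edge) (auto simp: induced_edges_def)
    obtain v where v: "v \<in> F" "v \<notin> A"
    proof -
      have "A \<noteq> F" using A(2) Suc.prems by auto
      then show thesis using AF that by auto
    qed
    show ?case
    proof (cases "r (comp v) \<in> A")
      case False
      let ?w = "r (comp v)"
      have wF: "?w \<in> F" using r_F v by auto
      \<comment> \<open>A neighbour in \<open>A\<close> would belong to the tree of
        \<open>?w\<close>, and the invariant would then put the root of that tree, which is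
        \<open>?w\<close> itself, into \<open>A\<close>.\<close>
      have N: "{} = {u\<in>A. {u, ?w} \<in> E}"
      proof -
        have False if "u \<in> A" "{u, ?w} \<in> E" for u
        proof -
          have "comp u = comp v" using edge[OF that(1) wF that(2)] r_comp[OF v(1)] by simp
          then show False using reach(1)[OF that(1)] False by simp
        qed
        then show ?thesis by auto
      qed
      have "?w \<in> R" using v by (auto simp: R_def comps)
      then have "R \<inter> insert ?w A = insert ?w (R \<inter> A)" by auto
      \<comment> \<open>No edge is gained; the charge \<open>(c ?w)\<^sup>2\<close> is the new root
        term. The vertex bounding the empty neighbour set is arbitrary, hence
        \<open>undefined\<close>.\<close>
      then have e: "(\<Sum>e\<in>induced_edges E (insert ?w A). (\<Sum>i\<in>e. c i)\<^sup>2) + (\<Sum>i\<in>R \<inter> insert ?w A. (c i)\<^sup>2) =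
        (\<Sum>e\<in>induced_edges E A. (\<Sum>i\<in>e. c i)\<^sup>2) + (\<Sum>i\<in>R \<inter> A. (c i)\<^sup>2) + (c ?w + (\<Sum>u\<in>{}. c u))\<^sup>2"
        using sum_induced_edges_insert[OF graph _ False N, of undefined c] AF FV False finA by simp
      have "good (insert ?w A)"
        unfolding good_def
      proof (intro conjI ballI)
        show "insert ?w A \<subseteq> F" using wF AF by auto
        show "elimination E c (insert ?w A) ((\<Sum>e\<in>induced_edges E (insert ?w A). (\<Sum>i\<in>e. c i)\<^sup>2) +
            (\<Sum>i\<in>R \<inter> insert ?w A. (c i)\<^sup>2))"
          unfolding e by (rule elimination.insert[OF elim False N]) auto
        fix u assume u: "u \<in> insert ?w A"
        show "r (comp u) \<in> insert ?w A"
          using u reach r_comp v by auto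
        show "reachable (induced_edges E (insert ?w A)) (r (comp u)) u"
        proof (cases "u = ?w")
          case True then show ?thesis using r_comp[OF v(1)] by (simp add: reachable_refl)
        next
          case False
          then have "u \<in> A" using u by simp
          then show ?thesis
            by (intro reachable_mono[OF _ reach(2)]) (auto simp: induced_edges_def)
        qed
      qed
      then show ?thesis using A False finA by (intro exI[of _ "insert ?w A"]) simp
    next
      case True
      \<comment> \<open>On the way from the root, which is in \<open>A\<close>, to \<open>v\<close>,
        which is not, some edge leaves \<open>A\<close>. Its outer end \<open>w\<close> is inserted,
        not necessarily \<open>v\<close>.\<close>
      have "reachable ?E (r (comp v)) v"
        using r[OF v(1)] by (subst reachable_sym) (auto simp: comp_def)
      then obtain a w where aw: "a \<in> A" "w \<notin> A" "{a, w} \<in> ?E"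
        by (rule reachable_exit[OF _ True v(2)])
      have wF: "w \<in> F" and awE: "{a, w} \<in> E" using aw by (auto simp: induced_edges_def)
      have caw: "comp a = comp w" using edge aw wF awE by blast
      have N: "{a} = {u\<in>A. {u, w} \<in> E}"
      proof -
        have "u = a" if u: "u \<in> A" "{u, w} \<in> E" for u
        proof (rule ccontr)
          assume "u \<noteq> a"
          have cua: "comp u = comp a" using edge[OF u(1) wF u(2)] caw by simp
          \<comment> \<open>By the invariant, \<open>a\<close> and \<open>u\<close> are both linked
            inside \<open>A\<close> to their common root, hence to each other; \<open>w\<close>
            would close a cycle.\<close>
          have "reachable (induced_edges E A) a (r (comp a))"
            using reach(2)[OF aw(1)] by (subst reachable_sym)
          then have "reachable (induced_edges E A) a u"
            using reach(2)[OF u(1)] unfolding cua by (rule reachable_trans)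
          then have "reachable (induced_edges ?E A) a u"
            using AF by (elim reachable_mono[rotated]) (auto simp: induced_edges_def)
          moreover have "{u, w} \<in> ?E" using u wF AF by (auto simp: induced_edges_def)
          ultimately obtain p where p: "graph_cycle ?E p" "\<And>z. z \<in> set p \<Longrightarrow> reachable ?E a z"
            using aw(1,2,3) \<open>u \<noteq> a\<close> graph_cycle_close_path[of ?E A a u w thesis] by simp
          have "\<not> graph_cycle ?E p"
          proof (rule is_forest_no_cycle[OF forest _ _ p(2)])
            show "a \<in> F" using aw(1) AF by auto
          qed (auto simp: induced_edges_def)
          then show False using p(1) by simp
        qed
        then show ?thesis using aw(1) awE by blast
      qed
      \<comment> \<open>The root of the tree of \<open>w\<close> is already in \<open>A\<close>, so
        no root term is added and only the edge to \<open>a\<close> is charged.\<close>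
      have "w \<notin> R" using R_root[of w] reach(1)[OF aw(1)] caw aw(2) by auto
      then have "R \<inter> insert w A = R \<inter> A" by auto
      then have e: "(\<Sum>e\<in>induced_edges E (insert w A). (\<Sum>i\<in>e. c i)\<^sup>2) + (\<Sum>i\<in>R \<inter> insert w A. (c i)\<^sup>2) =
        (\<Sum>e\<in>induced_edges E A. (\<Sum>i\<in>e. c i)\<^sup>2) + (\<Sum>i\<in>R \<inter> A. (c i)\<^sup>2) + (c w + (\<Sum>u\<in>{a}. c u))\<^sup>2"
        using sum_induced_edges_insert[OF graph _ aw(2) N, of a c] AF FV by simp
      have "good (insert w A)"
        unfolding good_def
      proof (intro conjI ballI)
        show "insert w A \<subseteq> F" using wF AF by auto
        show "elimination E c (insert w A) ((\<Sum>e\<in>induced_edges E (insert w A). (\<Sum>i\<in>e. c i)\<^sup>2) +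
            (\<Sum>i\<in>R \<inter> insert w A. (c i)\<^sup>2))"
          unfolding e by (rule elimination.insert[OF elim aw(2) N]) auto
        fix u assume u: "u \<in> insert w A"
        show "r (comp u) \<in> insert w A"
          using u reach(1) reach(1)[OF aw(1)] caw by auto
        have mono': "reachable (induced_edges E (insert w A)) (r (comp u)) u" if "u \<in> A" for u
          using that by (intro reachable_mono[OF _ reach(2)]) (auto simp: induced_edges_def)
        show "reachable (induced_edges E (insert w A)) (r (comp u)) u"
        proof (cases "u = w")
          case True
          have "{a, w} \<in> induced_edges E (insert w A)"
            using awE aw(1) by (auto simp: induced_edges_def)
          then have "reachable (induced_edges E (insert w A)) a w" by (rule reachable_edge)
          with mono'[OF aw(1)] show ?thesis
            unfolding True caw by (rule reachable_trans)
        qed (use u mono' in auto)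
      qed
      then show ?thesis using A aw(2) finA by (intro exI[of _ "insert w A"]) simp
    qed
  qed
  then obtain A where "good A" "card A = card F" by blast
  then have "good F"
    using card_subset_eq[OF \<open>finite F\<close>, of A] by (simp add: good_def)
  moreover have "(\<Sum>i\<in>R \<inter> F. (c i)\<^sup>2) = (\<Sum>T\<in>components F ?E. (Min (c ` T))\<^sup>2)"
  proof -
    have "R \<inter> F = r ` components F ?E" using r_F by (auto simp: R_def comps)
    moreover have "inj_on r (components F ?E)"
      using r_comp unfolding comps by (intro inj_onI) (metis imageE)
    ultimately show ?thesis
      using r by (simp add: sum.reindex comps) (intro sum.cong, auto)
  qed
  ultimately show ?thesis by (simp add: good_def forest_bound_def)
qed

subsection \<open>Moment generating function of a forest sum\<close>

text \<open>The measure must vary in the induction, since the hypothesis is applied to conditional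
  measures. Measurability, finite range and the pointwise intervals depend only on the measurable
  space and so survive the change.\<close>

lemma elimination_mgf:
  fixes M :: "'a measure" and X :: "'v \<Rightarrow> 'a \<Rightarrow> real"
  assumes "elimination E c A B" and "prob_space M" and "point_dependent M A E X"
    and "\<And>i. i \<in> A \<Longrightarrow> X i \<in> borel_measurable M"
    and "\<And>i. i \<in> A \<Longrightarrow> finite (X i ` space M)"
    and "\<And>i \<omega>. i \<in> A \<Longrightarrow> \<omega> \<in> space M \<Longrightarrow> X i \<omega> \<in> {a i..a i + c i}"
    and s: "0 < s"
  shows "(\<integral>\<omega>. exp (s * (\<Sum>i\<in>A. X i \<omega> - integral\<^sup>L M (X i))) \<partial>M) \<le> exp (s\<^sup>2 * B / 8)"
  using assms(1-6)
proof (induction arbitrary: M rule: elimination.induct)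
  case empty
  then interpret prob_space M by simp
  show ?case by (simp add: prob_space)
next
  case (insert A B v N p)
  interpret prob_space M by fact
  have "(\<integral>\<omega>. exp (s * (\<Sum>i\<in>insert v A. X i \<omega> - integral\<^sup>L M (X i))) \<partial>M)
      \<le> exp (s\<^sup>2 * (c v + (\<Sum>i\<in>N. c i))\<^sup>2 / 8) * exp (s\<^sup>2 * B / 8)"
  proof (rule mgf_insert[OF insert.prems(2) insert.hyps(2) elimination_finite[OF insert.hyps(1)]
        insert.prems(3,4,5) insert.hyps(3,4) s])
    fix U :: "'a measure"
    assume U: "prob_space U" "sets U = sets M" "point_dependent U A E X"
    have sp: "space U = space M" using U(2) by (rule sets_eq_imp_space_eq)
    show "(\<integral>\<omega>. exp (s * (\<Sum>i\<in>A. X i \<omega> - integral\<^sup>L U (X i))) \<partial>U) \<le> exp (s\<^sup>2 * B / 8)"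
    proof (rule insert.IH[OF U(1,3)])
      show "X i \<in> borel_measurable U" if "i \<in> A" for i
        using insert.prems(3)[of i] that U(2) by (simp cong: measurable_cong_sets)
    qed (use insert.prems(4,5) sp in auto)
  qed
  also have "\<dots> = exp (s\<^sup>2 * (B + (c v + (\<Sum>i\<in>N. c i))\<^sup>2) / 8)"
    by (simp add: algebra_simps add_divide_distrib flip: exp_add)
  finally show ?case .
qed

text \<open>Point events of the transformed variables are preimages of measurable boxes under the
  random vectors. The Borel functions \<open>f i\<close> will be the roundings.\<close>

lemma (in prob_space) graph_dependent_imp_point_dependent:
  assumes dep: "graph_dependent M V E X" and "finite V"
    and f[measurable]: "\<And>i. f i \<in> borel_measurable borel"
  shows "point_dependent M V E (\<lambda>i \<omega>. f i (X i \<omega>))"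
  unfolding point_dependent_def point_indep_def
proof (intro allI impI)
  fix S T and a :: "'b \<Rightarrow> real"
  assume ST: "S \<subseteq> V" "T \<subseteq> V" "S \<inter> T = {}" "\<forall>u\<in>S. \<forall>v\<in>T. {u, v} \<notin> E"
  have fin: "finite S" "finite T" using ST \<open>finite V\<close> by (auto intro: finite_subset)
  define P where "P S = PiE S (\<lambda>i. f i -` {a i})" for S
  have P: "P S \<in> sets (\<Pi>\<^sub>M i\<in>S. borel)" if "finite S" for S
    unfolding P_def using that measurable_sets_borel[OF f]
    by (intro sets_PiM_I_finite) auto
  have eq: "{\<omega>\<in>space M. \<forall>i\<in>S. f i (X i \<omega>) = a i} = (\<lambda>\<omega>. \<lambda>i\<in>S. X i \<omega>) -` P S \<inter> space M" for S
    by (auto simp: P_def PiE_def Pi_def)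
  have "indep_var (\<Pi>\<^sub>M i\<in>S. borel) (\<lambda>\<omega>. \<lambda>i\<in>S. X i \<omega>) (\<Pi>\<^sub>M j\<in>T. borel) (\<lambda>\<omega>. \<lambda>j\<in>T. X j \<omega>)"
    using dep ST unfolding graph_dependent_def by simp
  from indep_varD[OF this P P, OF fin]
  have "prob ((\<lambda>\<omega>. (\<lambda>i\<in>S. X i \<omega>, \<lambda>j\<in>T. X j \<omega>)) -` (P S \<times> P T) \<inter> space M) =
      prob {\<omega>\<in>space M. \<forall>i\<in>S. f i (X i \<omega>) = a i} * prob {\<omega>\<in>space M. \<forall>i\<in>T. f i (X i \<omega>) = a i}"
    unfolding eq .
  moreover have "(\<lambda>\<omega>. (\<lambda>i\<in>S. X i \<omega>, \<lambda>j\<in>T. X j \<omega>)) -` (P S \<times> P T) \<inter> space M =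
      {\<omega>\<in>space M. \<forall>i\<in>S \<union> T. f i (X i \<omega>) = a i}"
    by (auto simp: P_def PiE_def Pi_def)
  ultimately show "prob {\<omega>\<in>space M. \<forall>i\<in>S \<union> T. f i (X i \<omega>) = a i} =
      prob {\<omega>\<in>space M. \<forall>i\<in>S. f i (X i \<omega>) = a i} * prob {\<omega>\<in>space M. \<forall>i\<in>T. f i (X i \<omega>) = a i}"
    by simp
qed

text \<open>The bound for the rounded variables does not depend on the mesh \<open>\<delta>\<close>,
  and rounding costs only a factor \<open>exp (s * (real (card A) * \<delta>))\<close>, which tends
  to 1.\<close>

lemma (in prob_space) graph_dependent_mgf:
  fixes X :: "'v \<Rightarrow> 'a \<Rightarrow> real"
  assumes elim: "elimination E c A B" and dep: "graph_dependent M V E X"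
    and V: "finite V" "A \<subseteq> V"
    and rv: "\<And>i. i \<in> V \<Longrightarrow> random_variable borel (X i)"
    and bd: "\<And>i \<omega>. i \<in> V \<Longrightarrow> \<omega> \<in> space M \<Longrightarrow> X i \<omega> \<in> {a i..a i + c i}"
    and s: "0 < s"
  shows "expectation (\<lambda>\<omega>. exp (s * (\<Sum>i\<in>A. X i \<omega> - expectation (X i)))) \<le> exp (s\<^sup>2 * B / 8)"
proof -
  let ?L = "expectation (\<lambda>\<omega>. exp (s * (\<Sum>i\<in>A. X i \<omega> - expectation (X i))))"
  have bound: "?L \<le> exp (s * (real (card A) * \<delta>)) * exp (s\<^sup>2 * B / 8)" if \<delta>: "0 < \<delta>" for \<delta>
  proof -
    \<comment> \<open>The grid is anchored at \<open>a i\<close>, so rounding down stays in the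
      interval of length \<open>c i\<close> and the constants are not enlarged.\<close>
    define f where "f i x = a i + \<delta> * real_of_int \<lfloor>(x - a i) / \<delta>\<rfloor>" for i x
    have f_le: "f i x \<le> x" for i x
    proof -
      have "\<delta> * real_of_int \<lfloor>(x - a i) / \<delta>\<rfloor> \<le> \<delta> * ((x - a i) / \<delta>)"
        using \<delta> by (intro mult_left_mono) auto
      then show ?thesis using \<delta> by (simp add: f_def)
    qed
    have f_ge: "x \<le> f i x + \<delta>" for i x
    proof -
      have "\<delta> * ((x - a i) / \<delta>) \<le> \<delta> * (real_of_int \<lfloor>(x - a i) / \<delta>\<rfloor> + 1)"
        using \<delta> by (intro mult_left_mono) linarith+
      then have "x - a i \<le> \<delta> * (real_of_int \<lfloor>(x - a i) / \<delta>\<rfloor> + 1)" using \<delta> by simp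
      then show ?thesis by (simp add: f_def distrib_left)
    qed
    have [measurable]: "f i \<in> borel_measurable borel" for i
      unfolding f_def by measurable
    define Y where "Y i \<omega> = f i (X i \<omega>)" for i \<omega>
    have Ym: "random_variable borel (Y i)" if "i \<in> V" for i
      unfolding Y_def using rv[OF that] by measurable
    have Ybd: "Y i \<omega> \<in> {a i..a i + c i}" if "i \<in> V" "\<omega> \<in> space M" for i \<omega>
    proof -
      have "0 \<le> \<lfloor>(X i \<omega> - a i) / \<delta>\<rfloor>" using bd[OF that] \<delta> by simp
      then have "a i \<le> f i (X i \<omega>)" using \<delta> by (simp add: f_def)
      then show ?thesis using f_le[of i "X i \<omega>"] bd[OF that] by (simp add: Y_def)
    qed
    have Yfin: "finite (Y i ` space M)" if "i \<in> V" for i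
    proof (rule finite_subset)
      show "Y i ` space M \<subseteq> (\<lambda>k. a i + \<delta> * real_of_int k) ` {0..\<lfloor>c i / \<delta>\<rfloor>}"
      proof (rule image_subsetI)
        fix \<omega> assume "\<omega> \<in> space M"
        then have "0 \<le> X i \<omega> - a i" "X i \<omega> - a i \<le> c i" using bd[OF that, of \<omega>] by auto
        then have "\<lfloor>(X i \<omega> - a i) / \<delta>\<rfloor> \<in> {0..\<lfloor>c i / \<delta>\<rfloor>}"
          using \<delta> by (auto intro!: floor_mono divide_right_mono)
        then show "Y i \<omega> \<in> (\<lambda>k. a i + \<delta> * real_of_int k) ` {0..\<lfloor>c i / \<delta>\<rfloor>}"
          by (rule rev_image_eqI) (simp add: Y_def f_def)
      qed
    qed simp
    have Ydep: "point_dependent M A E Y"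
      unfolding Y_def
      by (rule point_dependent_subset[OF graph_dependent_imp_point_dependent[OF dep V(1), where f = f] V(2)]) simp
    have intX: "integrable M (X i)" if "i \<in> V" for i
      by (rule integrable_interval[OF rv[OF that] bd[OF that]])
    have intY: "integrable M (Y i)" if "i \<in> V" for i
      by (rule integrable_interval[OF Ym[OF that] Ybd[OF that]])
    have EY: "expectation (Y i) \<le> expectation (X i)" if "i \<in> V" for i
      using intX intY that f_le by (intro integral_mono) (auto simp: Y_def)
    \<comment> \<open>One-sided errors suffice: rounding down loses at most \<open>\<delta>\<close>
      pointwise, and the drop of the means acts in the favourable direction.\<close>
    have XY: "(\<Sum>i\<in>A. X i \<omega> - expectation (X i)) \<le>
        real (card A) * \<delta> + (\<Sum>i\<in>A. Y i \<omega> - expectation (Y i))" for \<omega>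
    proof -
      have "(\<Sum>i\<in>A. X i \<omega> - expectation (X i)) \<le> (\<Sum>i\<in>A. \<delta> + (Y i \<omega> - expectation (Y i)))"
      proof (rule sum_mono)
        fix i assume "i \<in> A"
        then have "i \<in> V" using V by auto
        then show "X i \<omega> - expectation (X i) \<le> \<delta> + (Y i \<omega> - expectation (Y i))"
          using EY[of i] f_ge[of "X i \<omega>" i] by (simp add: Y_def)
      qed
      then show ?thesis by (simp add: sum.distrib)
    qed
    have integ: "integrable M (\<lambda>\<omega>. exp (s * (\<Sum>i\<in>A. Z i \<omega> - expectation (Z i))))"
      if Z: "\<And>i. i \<in> V \<Longrightarrow> random_variable borel (Z i)"
        "\<And>i \<omega>. i \<in> V \<Longrightarrow> \<omega> \<in> space M \<Longrightarrow> Z i \<omega> \<in> {a i..a i + c i}" for Z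
    proof (rule integrable_interval[where a = 0])
      fix \<omega> assume "\<omega> \<in> space M"
      then have "Z i \<omega> \<le> a i + c i" if "i \<in> A" for i using Z V that by auto
      then show "exp (s * (\<Sum>i\<in>A. Z i \<omega> - expectation (Z i))) \<in>
          {0..exp (s * (\<Sum>i\<in>A. a i + c i - expectation (Z i)))}"
        using s by (auto intro!: sum_mono)
    next
      have "random_variable borel (Z i)" if "i \<in> A" for i using Z(1) V(2) that by auto
      note [measurable] = this
      show "random_variable borel (\<lambda>\<omega>. exp (s * (\<Sum>i\<in>A. Z i \<omega> - expectation (Z i))))"
        by measurable
    qed
    have "?L \<le> expectation (\<lambda>\<omega>. exp (s * (real (card A) * \<delta>)) *
        exp (s * (\<Sum>i\<in>A. Y i \<omega> - expectation (Y i))))"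
    proof (rule integral_mono)
      show "exp (s * (\<Sum>i\<in>A. X i \<omega> - expectation (X i))) \<le>
          exp (s * (real (card A) * \<delta>)) * exp (s * (\<Sum>i\<in>A. Y i \<omega> - expectation (Y i)))" for \<omega>
        using mult_left_mono[OF XY[of \<omega>], of s] s by (simp add: ring_distribs flip: exp_add)
    qed (intro integ rv bd integrable_mult_right Ym Ybd; assumption)+
    also have "\<dots> = exp (s * (real (card A) * \<delta>)) *
        expectation (\<lambda>\<omega>. exp (s * (\<Sum>i\<in>A. Y i \<omega> - expectation (Y i))))"
      by simp
    also have "\<dots> \<le> exp (s * (real (card A) * \<delta>)) * exp (s\<^sup>2 * B / 8)"
      by (intro mult_left_mono elimination_mgf[OF elim prob_space_axioms Ydep _ _ _ s, of a] Ym Yfin Ybd)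
        (use V in auto)
    finally show ?thesis .
  qed
  have "((\<lambda>\<delta>. exp (s * (real (card A) * \<delta>)) * exp (s\<^sup>2 * B / 8)) \<longlongrightarrow>
      exp (s * (real (card A) * 0)) * exp (s\<^sup>2 * B / 8)) (at_right 0)"
    by (intro tendsto_intros)
  moreover have "\<forall>\<^sub>F \<delta> in at_right 0. ?L \<le> exp (s * (real (card A) * \<delta>)) * exp (s\<^sup>2 * B / 8)"
    unfolding eventually_at_filter by (rule always_eventually) (use bound in blast)
  ultimately have "?L \<le> exp (s * (real (card A) * 0)) * exp (s\<^sup>2 * B / 8)"
    by (rule tendsto_lowerbound) (rule trivial_limit_at_right_real)
  then show ?thesis by simp
qed

subsection \<open>Attainment of the minimum\<close>

lemma forest_bound_nonneg: "0 \<le> forest_bound E c F"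
  by (simp add: forest_bound_def sum_nonneg)

lemma cover_value_eq: "cover_value E c C = (\<Sum>(F, w)\<leftarrow>C. w * sqrt (forest_bound E c F))\<^sup>2"
  by (simp add: cover_value_def forest_bound_def)

lemma simple_graph_induced_edges_small:
  assumes "simple_graph V E"
  shows "induced_edges E {v} = {}" "induced_edges E {} = {}"
proof -
  have "\<not> e \<subseteq> {v}" if "e \<in> E" for e
    using assms that card_mono[of "{v}" e] by (auto simp: simple_graph_def)
  then show "induced_edges E {v} = {}" "induced_edges E {} = {}"
    by (auto simp: induced_edges_def)
qed

text \<open>Guarantees that covers exist: the singletons with weight 1 form one.\<close>

lemma is_forest_singleton:
  assumes "simple_graph V E"
  shows "is_forest {v} (induced_edges E {v})"
proof -
  have "\<not> graph_cycle {} p" for p :: "'a list"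
    unfolding graph_cycle_def by (metis empty_iff less_le_trans zero_less_numeral)
  moreover have "components {v} {} = {{v}}"
    by (auto simp: components_eq reachable_refl)
  moreover have "induced_edges {} {v} = {}" by (simp add: induced_edges_def)
  ultimately show ?thesis
    unfolding simple_graph_induced_edges_small[OF assms]
    by (simp add: is_forest_def is_tree_def graph_connected_def reachable_refl)
qed

text \<open>Merges repeated sets by adding their weights, which turns a list into a weight vector on
  a fixed finite family. In the application the only entry outside \<open>\<F>\<close> is the empty
  set.\<close>

lemma sum_list_group:
  fixes g :: "'b \<Rightarrow> real"
  assumes "finite \<F>" and "\<And>F w. (F, w) \<in> set C \<Longrightarrow> F \<notin> \<F> \<Longrightarrow> g F = 0"
  shows "(\<Sum>(F, w)\<leftarrow>C. w * g F) = (\<Sum>F\<in>\<F>. (\<Sum>(F', w)\<leftarrow>C. if F' = F then w else 0) * g F)"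
  using assms(2)
proof (induction C)
  case (Cons x C)
  obtain F w where x: "x = (F, w)" by force
  have "(\<Sum>F'\<in>\<F>. (if F = F' then w else 0) * g F') = (\<Sum>F'\<in>\<F>. if F = F' then w * g F' else 0)"
    by (intro sum.cong) auto
  also have "\<dots> = w * g F"
    using assms(1) Cons.prems[of F w] by (simp add: x)
  finally have "(\<Sum>F'\<in>\<F>. (if F = F' then w else 0) * g F') = w * g F" .
  moreover have "(\<Sum>(F, w)\<leftarrow>C. w * g F) = (\<Sum>F\<in>\<F>. (\<Sum>(F', w)\<leftarrow>C. if F' = F then w else 0) * g F)"
    by (rule Cons.IH) (use Cons.prems in auto)
  ultimately show ?case
    by (simp add: x distrib_right sum.distrib)
qed simp

text \<open>Attainment is what gives the \<open>LEAST\<close> in \<open>D\<close> its meaning, and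
  it lets the tail bound be proved for one optimal cover.\<close>

lemma D_attained:
  assumes graph: "simple_graph V E"
  obtains C where "C \<in> FFC V E" "D V E c = cover_value E c C"
proof -
  have finV: "finite V" using graph by (simp add: simple_graph_def)
  define \<F> where "\<F> = {F. F \<subseteq> V \<and> F \<noteq> {} \<and> is_forest F (induced_edges E F)}"
  have fin: "finite \<F>" using finV by (auto simp: \<F>_def intro: finite_subset[of _ "Pow V"])
  let ?on = "\<lambda>v F. if v \<in> F then 1 else 0 :: real"
  \<comment> \<open>Weights are functions on all sets, so that compactness of the cube is
    Tychonoff's theorem. Coordinates outside \<open>\<F>\<close> are free, and neither the
    constraints nor \<open>\<phi>\<close> see them.\<close>
  define K where "K = {w :: 'a set \<Rightarrow> real. (\<forall>F. w F \<in> {0..1}) \<and> (\<forall>v\<in>V. (\<Sum>F\<in>\<F>. w F * ?on v F) = 1)}"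
  define \<phi> where "\<phi> w = (\<Sum>F\<in>\<F>. w F * sqrt (forest_bound E c F))\<^sup>2" for w
  have cont: "continuous_on UNIV (\<lambda>w :: 'a set \<Rightarrow> real. \<Sum>F\<in>\<F>. w F * g F)" for g
    by (intro continuous_intros continuous_on_product_coordinates)
  have "compact (PiE UNIV (\<lambda>_. {0..1}) :: ('a set \<Rightarrow> real) set)"
    using compactin_PiE[of "\<lambda>_ :: 'a set. euclidean :: real topology" UNIV "\<lambda>_. {0..1}"]
    by (simp add: euclidean_product_topology)
  moreover have "closed (\<Inter>v\<in>V. {w :: 'a set \<Rightarrow> real. (\<Sum>F\<in>\<F>. w F * ?on v F) = 1})"
    by (intro closed_INT ballI closed_Collect_eq cont continuous_on_const)
  moreover have "K = PiE UNIV (\<lambda>_. {0..1}) \<inter> (\<Inter>v\<in>V. {w. (\<Sum>F\<in>\<F>. w F * ?on v F) = 1})"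
    by (auto simp: K_def PiE_def Pi_def)
  ultimately have "compact K" by (simp add: compact_Int_closed)
  moreover have "K \<noteq> {}"
  proof -
    define w :: "'a set \<Rightarrow> real" where "w F = (if \<exists>v. F = {v} then 1 else 0)" for F
    have "(\<Sum>F\<in>\<F>. w F * ?on v F) = 1" if "v \<in> V" for v
    proof -
      have "(\<Sum>F\<in>\<F>. w F * ?on v F) = (\<Sum>F\<in>\<F>. if F = {v} then 1 else 0)"
        by (intro sum.cong) (auto simp: w_def)
      then show ?thesis
        using fin that is_forest_singleton[OF graph, of v] by (simp add: \<F>_def)
    qed
    then have "w \<in> K" by (auto simp: K_def w_def)
    then show ?thesis by auto
  qed
  moreover have "continuous_on K \<phi>"
    unfolding \<phi>_def by (intro continuous_on_power continuous_on_subset[OF cont]) auto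
  ultimately have "\<exists>x\<in>K. \<forall>y\<in>K. \<phi> x \<le> \<phi> y" by (rule continuous_attains_inf)
  then obtain w0 where w0: "w0 \<in> K" "\<And>w. w \<in> K \<Longrightarrow> \<phi> w0 \<le> \<phi> w" by auto
  obtain xs where xs: "distinct xs" "set xs = \<F>" using finite_distinct_list[OF fin] by auto
  define C0 where "C0 = map (\<lambda>F. (F, w0 F)) xs"
  have C0_sum: "(\<Sum>(F, w)\<leftarrow>C0. w * g F) = (\<Sum>F\<in>\<F>. w0 F * g F)" for g
    using xs by (simp add: C0_def o_def sum_list_distinct_conv_sum_set)
  have on_eq: "(\<Sum>(S, w)\<leftarrow>C. if v \<in> S then w else 0) = (\<Sum>(S, w)\<leftarrow>C. w * ?on v S)" for C :: "('a set \<times> real) list" and v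
    by (induction C) auto
  have C0: "C0 \<in> FFC V E"
  proof -
    have "(\<Sum>(S, w)\<leftarrow>C0. if v \<in> S then w else 0) = 1" if "v \<in> V" for v
      using w0(1) that unfolding on_eq C0_sum[of "?on v"] by (simp add: K_def)
    moreover have "S \<subseteq> V \<and> 0 \<le> w \<and> w \<le> 1 \<and> is_forest S (induced_edges E S)" if "(S, w) \<in> set C0" for S w
    proof -
      have "S \<in> \<F>" "w = w0 S" using that xs(2) by (auto simp: C0_def)
      then show ?thesis using w0(1) by (simp add: K_def \<F>_def)
    qed
    ultimately show ?thesis unfolding FFC_def fractional_vertex_cover_def by blast
  qed
  have C0_val: "cover_value E c C0 = \<phi> w0"
    by (simp add: cover_value_eq C0_sum \<phi>_def)
  have "cover_value E c C0 \<le> cover_value E c C" if C: "C \<in> FFC V E" for C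
  proof -
    define w where "w F = (if F \<in> \<F> then \<Sum>(F', w)\<leftarrow>C. if F' = F then w else 0 else 0)" for F
    have nonneg: "0 \<le> u" if "(S, u) \<in> set C" for S u
      using C that by (auto simp: FFC_def fractional_vertex_cover_def)
    have F: "S \<in> \<F>" if "(S, u) \<in> set C" "S \<noteq> {}" for S u
      using C that by (auto simp: FFC_def fractional_vertex_cover_def \<F>_def)
    have group: "(\<Sum>(F, w)\<leftarrow>C. w * g F) = (\<Sum>F\<in>\<F>. w F * g F)" if "g {} = 0" for g
    proof -
      have "g S = 0" if "(S, u) \<in> set C" "S \<notin> \<F>" for S u
        using F[OF that(1)] that(2) \<open>g {} = 0\<close> by (cases "S = {}") auto
      from sum_list_group[OF fin, of C g, OF this] show ?thesis
        by (simp add: w_def)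
    qed
    have one: "(\<Sum>(S, u)\<leftarrow>C. if v \<in> S then u else 0) = 1" if "v \<in> V" for v
      using C that by (auto simp: FFC_def fractional_vertex_cover_def)
    \<comment> \<open>A merged weight is at most 1 because it is part of the covering sum of any
      \<open>v\<close> in \<open>F\<close>. For the empty set there is no such \<open>v\<close>,
      which is why \<open>\<F>\<close> excludes it.\<close>
    have "w F \<in> {0..1}" for F
    proof (cases "F \<in> \<F>")
      case True
      then obtain v where v: "v \<in> F" "v \<in> V" by (auto simp: \<F>_def)
      have "0 \<le> (\<Sum>(F', w)\<leftarrow>C. if F' = F then w else 0)"
        using nonneg by (auto intro!: sum_list_nonneg)
      moreover have "(\<Sum>(F', w)\<leftarrow>C. if F' = F then w else 0) \<le> (\<Sum>(S, u)\<leftarrow>C. if v \<in> S then u else 0)"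
        using nonneg v by (intro sum_list_mono) auto
      ultimately show ?thesis using True one[OF v(2)] by (simp add: w_def)
    qed (simp add: w_def)
    moreover have "(\<Sum>F\<in>\<F>. w F * ?on v F) = 1" if "v \<in> V" for v
      using one[OF that] group[of "?on v"] unfolding on_eq by simp
    ultimately have "w \<in> K" by (auto simp: K_def)
    moreover have "cover_value E c C = \<phi> w"
    proof -
      have "forest_bound E c {} = 0"
        using simple_graph_induced_edges_small(2)[OF graph]
        by (simp add: forest_bound_def components_eq)
      then show ?thesis using group[of "\<lambda>F. sqrt (forest_bound E c F)"]
        by (simp add: cover_value_eq \<phi>_def)
    qed
    ultimately show ?thesis using w0(2) C0_val by simp
  qed
  then have "D V E c = cover_value E c C0"
    unfolding D_def using C0 by (intro Least_equality) auto
  then show thesis using that C0 by blast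
qed

subsection \<open>Tail bound from a fractional cover\<close>

text \<open>After swapping the sums, each vertex collects total weight 1. Indexing by positions
  keeps repeated sets apart.\<close>

lemma sum_fractional_cover:
  fixes z :: "'v \<Rightarrow> real"
  assumes "fractional_vertex_cover V C" and "finite V"
  shows "(\<Sum>i\<in>V. z i) = (\<Sum>k<length C. snd (C ! k) * (\<Sum>i\<in>fst (C ! k). z i))"
proof -
  have sub: "fst (C ! k) \<subseteq> V" if "k < length C" for k
    using assms(1) that nth_mem[of k C] by (cases "C ! k") (auto simp: fractional_vertex_cover_def)
  have "(\<Sum>k<length C. snd (C ! k) * (\<Sum>i\<in>fst (C ! k). z i)) =
      (\<Sum>k<length C. \<Sum>i\<in>V. (if i \<in> fst (C ! k) then snd (C ! k) else 0) * z i)"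
  proof (rule sum.cong)
    fix k assume "k \<in> {..<length C}"
    then have "(\<Sum>i\<in>fst (C ! k). z i) = (\<Sum>i\<in>V. if i \<in> fst (C ! k) then z i else 0)"
      using sub[of k] \<open>finite V\<close> by (simp add: sum.inter_restrict[symmetric] Int_absorb1)
    then show "snd (C ! k) * (\<Sum>i\<in>fst (C ! k). z i) =
        (\<Sum>i\<in>V. (if i \<in> fst (C ! k) then snd (C ! k) else 0) * z i)"
      by (simp add: sum_distrib_left if_distrib if_distribR cong: if_cong)
  qed simp
  also have "\<dots> = (\<Sum>i\<in>V. (\<Sum>k<length C. if i \<in> fst (C ! k) then snd (C ! k) else 0) * z i)"
    by (subst sum.swap) (simp add: sum_distrib_right)
  also have "\<dots> = (\<Sum>i\<in>V. z i)"
  proof (rule sum.cong)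
    fix i assume "i \<in> V"
    then have "(\<Sum>(S, w)\<leftarrow>C. if i \<in> S then w else 0) = 1"
      using assms(1) by (simp add: fractional_vertex_cover_def)
    then have "(\<Sum>k<length C. if i \<in> fst (C ! k) then snd (C ! k) else 0) = 1"
      by (simp add: sum_list_sum_nth atLeast0LessThan case_prod_unfold)
    then show "(\<Sum>k<length C. if i \<in> fst (C ! k) then snd (C ! k) else 0) * z i = z i" by simp
  qed simp
  finally show ?thesis by simp
qed

text \<open>Jensen's inequality replaces independence between forests. \<open>b F\<close> stands for
  a strictly positive upper bound of the square root of \<open>forest_bound E c F\<close>; it has to
  be positive because the scaling divides by it.\<close>

lemma (in prob_space) FFC_mgf:
  fixes X :: "'v \<Rightarrow> 'a \<Rightarrow> real"
  assumes graph: "simple_graph V E" and dep: "graph_dependent M V E X"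
    and rv: "\<And>i. i \<in> V \<Longrightarrow> random_variable borel (X i)"
    and bd: "\<And>i \<omega>. i \<in> V \<Longrightarrow> \<omega> \<in> space M \<Longrightarrow> X i \<omega> \<in> {a i..a i + c i}"
    and C: "C \<in> FFC V E" and s: "0 < s"
    and b: "\<And>F. 0 < b F" "\<And>F. forest_bound E c F \<le> (b F)\<^sup>2"
    and W: "W = (\<Sum>(F, w)\<leftarrow>C. w * b F)" "0 < W"
  shows "expectation (\<lambda>\<omega>. exp (s * (\<Sum>i\<in>V. X i \<omega> - expectation (X i)))) \<le> exp (s\<^sup>2 * W\<^sup>2 / 8)"
proof -
  have finV: "finite V" using graph by (simp add: simple_graph_def)
  define n where "n = length C"
  define F where "F k = fst (C ! k)" for k
  define w where "w k = snd (C ! k)" for k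
  \<comment> \<open>The probabilities \<open>p k\<close> and the scales \<open>l k\<close> below
    satisfy \<open>p k * l k = s * w k\<close>, which recovers the sum, while
    \<open>l k * b (F k) = s * W\<close> for every \<open>k\<close>, which gives all forests the
    same bound.\<close>
  define p where "p k = w k * b (F k) / W" for k
  define Y where "Y k \<omega> = (\<Sum>i\<in>F k. X i \<omega> - expectation (X i))" for k \<omega>
  define l where "l k = s * W / b (F k)" for k
  have Ck: "F k \<subseteq> V" "0 \<le> w k" "is_forest (F k) (induced_edges E (F k))" if "k < n" for k
  proof -
    have "(F k, w k) \<in> set C" using that by (simp add: F_def w_def n_def)
    then show "F k \<subseteq> V" "0 \<le> w k" "is_forest (F k) (induced_edges E (F k))"
      using C by (auto simp: FFC_def fractional_vertex_cover_def)
  qed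
  have W_sum: "W = (\<Sum>k<n. w k * b (F k))"
    by (simp add: W(1) F_def w_def n_def sum_list_sum_nth atLeast0LessThan case_prod_unfold)
  have p_nonneg: "0 \<le> p k" if "k < n" for k
    using Ck(2)[OF that] W(2) b(1)[of "F k"] by (simp add: p_def)
  have p_sum: "(\<Sum>k<n. p k) = 1"
    using W_sum W(2) by (simp add: p_def flip: sum_divide_distrib)
  have n0: "n \<noteq> 0" using p_sum by (cases n) auto
  have l_pos: "0 < l k" for k using s W(2) b(1)[of "F k"] by (simp add: l_def)
  have pl: "p k * l k = s * w k" for k
    using W(2) b(1)[of "F k"] by (simp add: p_def l_def)
  have split: "s * (\<Sum>i\<in>V. X i \<omega> - expectation (X i)) = (\<Sum>k<n. p k *\<^sub>R (l k * Y k \<omega>))" for \<omega>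
  proof -
    have "(\<Sum>i\<in>V. X i \<omega> - expectation (X i)) = (\<Sum>k<n. w k * Y k \<omega>)"
      using sum_fractional_cover[OF _ finV] C by (simp add: FFC_def n_def w_def Y_def F_def)
    then show ?thesis by (simp add: sum_distrib_left pl flip: mult.assoc)
  qed
  have conv: "exp (s * (\<Sum>i\<in>V. X i \<omega> - expectation (X i))) \<le> (\<Sum>k<n. p k * exp (l k * Y k \<omega>))" for \<omega>
    unfolding split
    by (rule convex_on_sum[OF _ _ exp_convex p_sum]) (use n0 p_nonneg in auto)
  have integ: "integrable M (\<lambda>\<omega>. exp (r * (\<Sum>i\<in>A. X i \<omega> - expectation (X i))))" if "A \<subseteq> V" "0 < r" for A r
  proof (rule integrable_interval[where a = 0])
    fix \<omega> assume "\<omega> \<in> space M"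
    then have "X i \<omega> \<le> a i + c i" if "i \<in> A" for i using bd[of i \<omega>] \<open>A \<subseteq> V\<close> that by auto
    then show "exp (r * (\<Sum>i\<in>A. X i \<omega> - expectation (X i))) \<in>
        {0..exp (r * (\<Sum>i\<in>A. a i + c i - expectation (X i)))}"
      using \<open>0 < r\<close> by (auto intro!: sum_mono)
  next
    have "random_variable borel (X i)" if "i \<in> A" for i using rv \<open>A \<subseteq> V\<close> that by auto
    note [measurable] = this
    show "random_variable borel (\<lambda>\<omega>. exp (r * (\<Sum>i\<in>A. X i \<omega> - expectation (X i))))"
      by measurable
  qed
  have integY: "integrable M (\<lambda>\<omega>. exp (l k * Y k \<omega>))" if "k < n" for k
    unfolding Y_def by (rule integ[OF Ck(1)[OF that] l_pos])
  have mgfY: "expectation (\<lambda>\<omega>. exp (l k * Y k \<omega>)) \<le> exp (s\<^sup>2 * W\<^sup>2 / 8)" if "k < n" for k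
  proof -
    have "expectation (\<lambda>\<omega>. exp (l k * Y k \<omega>)) \<le> exp ((l k)\<^sup>2 * forest_bound E c (F k) / 8)"
      unfolding Y_def
      by (rule graph_dependent_mgf[OF forest_elimination[OF graph Ck(1)[OF that] Ck(3)[OF that]]
            dep finV Ck(1)[OF that] rv bd l_pos])
    also have "(l k)\<^sup>2 * forest_bound E c (F k) \<le> (l k)\<^sup>2 * (b (F k))\<^sup>2"
      using b(2) by (intro mult_left_mono) auto
    also have "(l k)\<^sup>2 * (b (F k))\<^sup>2 = s\<^sup>2 * W\<^sup>2"
      using b(1)[of "F k"] by (simp add: l_def power_divide power_mult_distrib)
    finally show ?thesis by simp
  qed
  have "expectation (\<lambda>\<omega>. exp (s * (\<Sum>i\<in>V. X i \<omega> - expectation (X i))))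
      \<le> expectation (\<lambda>\<omega>. \<Sum>k<n. p k * exp (l k * Y k \<omega>))"
    by (rule integral_mono[OF integ[OF order_refl s] _ conv])
      (intro Bochner_Integration.integrable_sum integrable_mult_right integY, simp)
  also have "\<dots> = (\<Sum>k<n. p k * expectation (\<lambda>\<omega>. exp (l k * Y k \<omega>)))"
    by (subst Bochner_Integration.integral_sum) (use integY in auto)
  also have "\<dots> \<le> (\<Sum>k<n. p k * exp (s\<^sup>2 * W\<^sup>2 / 8))"
    using mgfY p_nonneg by (intro sum_mono mult_left_mono) auto
  also have "\<dots> = exp (s\<^sup>2 * W\<^sup>2 / 8)"
    using p_sum by (simp flip: sum_distrib_right)
  finally show ?thesis .
qed

lemma (in prob_space) FFC_tail:
  fixes X :: "'v \<Rightarrow> 'a \<Rightarrow> real"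
  assumes graph: "simple_graph V E" and dep: "graph_dependent M V E X"
    and rv: "\<And>i. i \<in> V \<Longrightarrow> random_variable borel (X i)"
    and bd: "\<And>i \<omega>. i \<in> V \<Longrightarrow> \<omega> \<in> space M \<Longrightarrow> X i \<omega> \<in> {a i..a i + c i}"
    and C: "C \<in> FFC V E" and t: "0 < t"
    and b: "\<And>F. 0 < b F" "\<And>F. forest_bound E c F \<le> (b F)\<^sup>2"
    and W: "W = (\<Sum>(F, w)\<leftarrow>C. w * b F)" "0 < W"
  shows "prob {\<omega>\<in>space M. t \<le> (\<Sum>i\<in>V. X i \<omega> - expectation (X i))} \<le> exp (- (2 * t\<^sup>2 / W\<^sup>2))"
proof -
  \<comment> \<open>This value minimises the exponent
    \<open>- s * t + s\<^sup>2 * W\<^sup>2 / 8\<close>.\<close>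
  define s where "s = 4 * t / W\<^sup>2"
  have s: "0 < s" using t W(2) by (simp add: s_def)
  let ?Z = "\<lambda>\<omega>. \<Sum>i\<in>V. X i \<omega> - expectation (X i)"
  note [measurable] = rv
  have "integrable M (\<lambda>\<omega>. exp (s * ?Z \<omega>))"
  proof (rule integrable_interval[where a = 0])
    fix \<omega> assume "\<omega> \<in> space M"
    then have "X i \<omega> \<le> a i + c i" if "i \<in> V" for i using bd[of i \<omega>] that by auto
    then show "exp (s * ?Z \<omega>) \<in> {0..exp (s * (\<Sum>i\<in>V. a i + c i - expectation (X i)))}"
      using s by (auto intro!: sum_mono)
  qed measurable
  then have "set_integrable M (space M) (\<lambda>\<omega>. exp (s * ?Z \<omega>))"
    unfolding set_integrable_def by (rule integrable_mult_indicator[OF sets.top])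
  from Chernoff_ineq_ge[OF s this sets.top, of t]
  have "prob {\<omega>\<in>space M. t \<le> ?Z \<omega>} \<le> exp (- s * t) * expectation (\<lambda>\<omega>. exp (s * ?Z \<omega>))"
    by (simp add: set_integral_space[OF \<open>integrable M (\<lambda>\<omega>. exp (s * ?Z \<omega>))\<close>])
  also have "\<dots> \<le> exp (- s * t) * exp (s\<^sup>2 * W\<^sup>2 / 8)"
    by (intro mult_left_mono FFC_mgf[OF graph dep rv bd C s b W]) auto
  also have "\<dots> = exp (- (2 * t\<^sup>2 / W\<^sup>2))"
    using W(2) by (simp add: s_def power2_eq_square field_simps flip: exp_add)
  finally show ?thesis .
qed

(* If D V E c = 0, the bound exp (- 2 t^2 / D V E c) is read as its limit exp (- infinity) = 0;
   Isabelle's division by zero would make it 1. *)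
theorem corollary2p6:
  fixes M :: "'a measure" and V :: "'v set" and E :: "'v set set"
    and X :: "'v \<Rightarrow> 'a \<Rightarrow> real" and c :: "'v \<Rightarrow> real" and t :: real
  assumes "prob_space M"
    and "simple_graph V E"
    and "\<And>i. i \<in> V \<Longrightarrow> X i \<in> borel_measurable M"
    and "graph_dependent M V E X"
    and "\<And>i. i \<in> V \<Longrightarrow> 0 \<le> c i"
    and "\<And>i. i \<in> V \<Longrightarrow> \<exists>a. \<forall>\<omega>\<in>space M. X i \<omega> \<in> {a..a + c i}"
    and "0 < t"
  shows "measure M {\<omega> \<in> space M. (\<Sum>i\<in>V. X i \<omega>) - (\<integral>\<omega>'. (\<Sum>i\<in>V. X i \<omega>') \<partial>M) \<ge> t}
         \<le> (if D V E c = 0 then 0 else exp (- (2 * t\<^sup>2 / D V E c)))"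
proof -
  interpret prob_space M by fact
  obtain a where bd: "\<And>i \<omega>. i \<in> V \<Longrightarrow> \<omega> \<in> space M \<Longrightarrow> X i \<omega> \<in> {a i..a i + c i}"
    using assms(6) by metis
  obtain C where C: "C \<in> FFC V E" "D V E c = cover_value E c C"
    using D_attained[OF assms(2)] .
  define W where "W = (\<Sum>(F, w)\<leftarrow>C. w * sqrt (forest_bound E c F))"
  have w: "0 \<le> w" if "(F, w) \<in> set C" for F w
    using C(1) that by (auto simp: FFC_def fractional_vertex_cover_def)
  have DW: "D V E c = W\<^sup>2" by (simp add: C(2) cover_value_eq W_def)
  have W0: "0 \<le> W" unfolding W_def
    by (rule sum_list_nonneg) (auto intro!: mult_nonneg_nonneg real_sqrt_ge_zero forest_bound_nonneg elim: w)
  let ?P = "prob {\<omega>\<in>space M. t \<le> (\<Sum>i\<in>V. X i \<omega> - expectation (X i))}"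
  have int: "integrable M (X i)" if "i \<in> V" for i
    by (rule integrable_interval[OF assms(3)[OF that] bd[OF that]])
  have P: "measure M {\<omega> \<in> space M. (\<Sum>i\<in>V. X i \<omega>) - (\<integral>\<omega>'. (\<Sum>i\<in>V. X i \<omega>') \<partial>M) \<ge> t} = ?P"
    by (simp add: Bochner_Integration.integral_sum[OF int] sum_subtractf)
  show ?thesis
  proof (cases "V = {}")
    \<comment> \<open>Here the cover may be the empty list, so the total weight \<open>S\<close>
      used below could be 0. The event itself is empty, as an empty sum does not reach
      \<open>t\<close>.\<close>
    case True
    then show ?thesis using \<open>0 < t\<close> by simp
  next
    case False
    define S where "S = (\<Sum>(F, w)\<leftarrow>C. w)"
    have S: "0 < S"
    proof -
      obtain v where "v \<in> V" using False by auto
      then have "1 = (\<Sum>(F, w)\<leftarrow>C. if v \<in> F then w else 0)"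
        using C(1) by (simp add: FFC_def fractional_vertex_cover_def)
      also have "\<dots> \<le> S" unfolding S_def using w by (intro sum_list_mono) auto
      finally show ?thesis by simp
    qed
    \<comment> \<open>The shift by \<open>\<epsilon>\<close> keeps the Jensen weights well defined when some \<open>forest_bound\<close> vanishes.\<close>
    have tail: "?P \<le> exp (- (2 * t\<^sup>2 / (W + \<epsilon> * S)\<^sup>2))" if "0 < \<epsilon>" for \<epsilon>
    proof (rule FFC_tail[OF assms(2,4,3) bd C(1) \<open>0 < t\<close>,
          where b = "\<lambda>F. sqrt (forest_bound E c F) + \<epsilon>"])
      show "0 < sqrt (forest_bound E c F) + \<epsilon>" for F
        using that forest_bound_nonneg[of E c F] by (simp add: add_nonneg_pos)
      show "forest_bound E c F \<le> (sqrt (forest_bound E c F) + \<epsilon>)\<^sup>2" for F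
        using that forest_bound_nonneg[of E c F] by (simp add: power2_sum)
      show "W + \<epsilon> * S = (\<Sum>(F, w)\<leftarrow>C. w * (sqrt (forest_bound E c F) + \<epsilon>))"
        unfolding W_def S_def by (induction C) (auto simp: algebra_simps)
      show "0 < W + \<epsilon> * S" using W0 S that by (simp add: add_nonneg_pos)
    qed
    have lim: "((\<lambda>\<epsilon>. W + \<epsilon> * S) \<longlongrightarrow> W + 0 * S) (at_right 0)"
      by (intro tendsto_intros)
    have "?P \<le> (if W = 0 then 0 else exp (- (2 * t\<^sup>2 / W\<^sup>2)))"
    proof (cases "W = 0")
      case True
      \<comment> \<open>The exponential bound has no value at \<open>\<epsilon> = 0\<close> when
        \<open>W = 0\<close>. Weakening it by \<open>exp (- x) \<le> inverse x\<close> gives a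
        polynomial in \<open>\<epsilon>\<close> that tends to 0.\<close>
      have "?P \<le> (W + \<epsilon> * S)\<^sup>2 / (2 * t\<^sup>2)" if "0 < \<epsilon>" for \<epsilon>
      proof -
        let ?x = "2 * t\<^sup>2 / (W + \<epsilon> * S)\<^sup>2"
        have x: "0 < ?x" using W0 S that \<open>0 < t\<close> True by simp
        have "?x \<le> exp ?x" using exp_ge_add_one_self[of ?x] by linarith
        then have "exp (- ?x) \<le> inverse ?x"
          unfolding exp_minus using x by (rule le_imp_inverse_le)
        then show ?thesis using tail[OF that] by simp
      qed
      then have "\<forall>\<^sub>F \<epsilon> in at_right 0. ?P \<le> (W + \<epsilon> * S)\<^sup>2 / (2 * t\<^sup>2)"
        unfolding eventually_at_filter by (intro always_eventually) simp
      moreover have "((\<lambda>\<epsilon>. (W + \<epsilon> * S)\<^sup>2 / (2 * t\<^sup>2)) \<longlongrightarrow> (W + 0 * S)\<^sup>2 / (2 * t\<^sup>2)) (at_right 0)"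
        by (intro tendsto_intros lim) (use \<open>0 < t\<close> in simp)
      ultimately have "?P \<le> (W + 0 * S)\<^sup>2 / (2 * t\<^sup>2)"
        by (intro tendsto_lowerbound[OF _ _ trivial_limit_at_right_real])
      then show ?thesis using True by simp
    next
      case False
      have "\<forall>\<^sub>F \<epsilon> in at_right 0. ?P \<le> exp (- (2 * t\<^sup>2 / (W + \<epsilon> * S)\<^sup>2))"
        unfolding eventually_at_filter by (intro always_eventually) (simp add: tail)
      moreover have "((\<lambda>\<epsilon>. exp (- (2 * t\<^sup>2 / (W + \<epsilon> * S)\<^sup>2))) \<longlongrightarrow>
          exp (- (2 * t\<^sup>2 / (W + 0 * S)\<^sup>2))) (at_right 0)"
        by (intro tendsto_intros lim) (use False in simp)
      ultimately have "?P \<le> exp (- (2 * t\<^sup>2 / (W + 0 * S)\<^sup>2))"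
        by (intro tendsto_lowerbound[OF _ _ trivial_limit_at_right_real])
      then show ?thesis using False by simp
    qed
    then show ?thesis unfolding P DW by simp
  qed
qed

end
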